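(* Let $p\in\mathbb{N}$ and let $J$ be the periodic Jacobi operator on $\ell^2(\mathbb{Z})$ with real coefficient sequences $\{a_i\}_{i\in\mathbb{Z}}$, $\{b_i\}_{i\in\mathbb{Z}}$, $\{c_i\}_{i\in\mathbb{Z}}$, all periodic with the same period $p$. Define $\omega_{b_0c}=\max\{|b_0-c_i|: i=0,1,\ldots,p-1\}$. Then $\Lambda_{r}(J)$ is path-connected, where $$r=3\sqrt{(p-1)\left(\omega_{a_0}^2+\omega_{b_0}^2+\omega_{b_0c}^2\right)}.$$
   Context: For real sequences $\{a_i\},\{b_i\},\{c_i\}$ indexed by $\mathbb{Z}$ with $a_{i+p}=a_i$, $b_{i+p}=b_i$, $c_{i+p}=c_i$ for all $i$, the periodic Jacobi operator $J$ is the bounded (in general non-normal) linear operator on the complex Hilbert space $\ell^2(\mathbb{Z})$ given by the tridiagonal matrix with $$(Ju)_n=c_{n-1}u_{n-1}+a_nu_n+b_nu_{n+1},\qquad n\in\mathbb{Z}.$$ For a bounded operator $A$ on a complex Hilbert space with spectrum $\sigma(A)$ and $\epsilon>0$, the $\epsilon$-pseudospectrum is $$\Lambda_\epsilon(A)=\sigma(A)\cup\{z\in\mathbb{C}:\ z\notin\sigma(A),\ \|(zI-A)^{-1}\|\ge \epsilon^{-1}\},$$ and $\Lambda_0(A)=\sigma(A)$. Notation: $\omega_{a_0}=\max\{|a_i-a_0|: i=0,1,2,\ldots\}$ and $\omega_{b_0}=\max\{|b_i-b_0|: i=0,1,2,\ldots\}$. *)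

theory Defs
  imports "HOL-Analysis.Analysis"
begin

typedef 'i ell2 = "{u :: 'i \<Rightarrow> complex. (\<lambda>n. (cmod (u n))\<^sup>2) summable_on UNIV}"
  morphisms ell2_nth Abs_ell2
  by (rule exI[of _ "\<lambda>_. 0"]) simp

setup_lifting type_definition_ell2

lemma ell2_scale_mem:
  fixes u :: "'i \<Rightarrow> complex"
  assumes "(\<lambda>n. (cmod (u n))\<^sup>2) summable_on UNIV"
  shows "(\<lambda>n. (cmod (z * u n))\<^sup>2) summable_on UNIV"
  using summable_on_cmult_right[OF assms, of "(cmod z)\<^sup>2"]
  by (simp add: norm_mult power_mult_distrib)

lemma ell2_add_mem:
  fixes u v :: "'i \<Rightarrow> complex"
  assumes "(\<lambda>n. (cmod (u n))\<^sup>2) summable_on UNIV" "(\<lambda>n. (cmod (v n))\<^sup>2) summable_on UNIV"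
  shows "(\<lambda>n. (cmod (u n + v n))\<^sup>2) summable_on UNIV"
proof (rule summable_on_comparison_test)
  show "(\<lambda>n. 2 * (cmod (u n))\<^sup>2 + 2 * (cmod (v n))\<^sup>2) summable_on UNIV"
    by (intro summable_on_add summable_on_cmult_right assms)
  fix n
  have "(cmod (u n + v n))\<^sup>2 \<le> (cmod (u n) + cmod (v n))\<^sup>2"
    by (intro power_mono norm_triangle_ineq) auto
  also have "\<dots> \<le> 2 * (cmod (u n))\<^sup>2 + 2 * (cmod (v n))\<^sup>2"
    using sum_squares_bound[of "cmod (u n)" "cmod (v n)"] by (simp add: power2_sum)
  finally show "(cmod (u n + v n))\<^sup>2 \<le> 2 * (cmod (u n))\<^sup>2 + 2 * (cmod (v n))\<^sup>2" .
qed auto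

lemma ell2_inner_summable:
  fixes u v :: "'i \<Rightarrow> complex"
  assumes "(\<lambda>n. (cmod (u n))\<^sup>2) summable_on UNIV" "(\<lambda>n. (cmod (v n))\<^sup>2) summable_on UNIV"
  shows "(\<lambda>n. u n \<bullet> v n) summable_on UNIV"
proof -
  have eq: "u n \<bullet> v n = (1/2) * ((cmod (u n + v n))\<^sup>2 + (-1) * ((cmod (u n))\<^sup>2 + (cmod (v n))\<^sup>2))" for n
    unfolding dot_norm by simp
  have "(\<lambda>n. (cmod (u n + v n))\<^sup>2 + (-1) * ((cmod (u n))\<^sup>2 + (cmod (v n))\<^sup>2)) summable_on UNIV"
    by (rule summable_on_add[OF ell2_add_mem[OF assms] summable_on_cmult_right[OF summable_on_add[OF assms]]])
  then show ?thesis
    unfolding eq by (rule summable_on_cmult_right)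
qed

lift_definition cscale_ell2 :: "complex \<Rightarrow> 'i ell2 \<Rightarrow> 'i ell2"  (infixr "*\<^sub>C" 75)
  is "\<lambda>z u n. z * u n"
  by (rule ell2_scale_mem)

instantiation ell2 :: (type) real_vector
begin

lift_definition zero_ell2 :: "'a ell2" is "\<lambda>_. 0"
  by simp

lift_definition plus_ell2 :: "'a ell2 \<Rightarrow> 'a ell2 \<Rightarrow> 'a ell2" is "\<lambda>u v n. u n + v n"
  by (rule ell2_add_mem)

lift_definition uminus_ell2 :: "'a ell2 \<Rightarrow> 'a ell2" is "\<lambda>u n. - u n"
  by simp

lift_definition minus_ell2 :: "'a ell2 \<Rightarrow> 'a ell2 \<Rightarrow> 'a ell2" is "\<lambda>u v n. u n - v n"
  using ell2_add_mem[where v = "\<lambda>n. - v n" for v] by simp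

lift_definition scaleR_ell2 :: "real \<Rightarrow> 'a ell2 \<Rightarrow> 'a ell2" is "\<lambda>r u n. of_real r * u n"
  by (rule ell2_scale_mem)

instance
proof
  fix x y z :: "'a ell2" and r s :: real
  show "x + y + z = x + (y + z)" by transfer (simp add: add.assoc)
  show "x + y = y + x" by transfer (simp add: add.commute)
  show "0 + x = x" by transfer simp
  show "- x + x = 0" by transfer simp
  show "x - y = x + - y" by transfer simp
  show "r *\<^sub>R (x + y) = r *\<^sub>R x + r *\<^sub>R y" by transfer (simp add: algebra_simps)
  show "(r + s) *\<^sub>R x = r *\<^sub>R x + s *\<^sub>R x" by transfer (simp add: algebra_simps)
  show "r *\<^sub>R s *\<^sub>R x = (r * s) *\<^sub>R x" by transfer (simp add: algebra_simps)
  show "1 *\<^sub>R x = x" by transfer simp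
qed

end

instantiation ell2 :: (type) real_inner
begin

(* The real part of the usual complex inner product. *)
lift_definition inner_ell2 :: "'a ell2 \<Rightarrow> 'a ell2 \<Rightarrow> real" is "\<lambda>u v. \<Sum>\<^sub>\<infinity>n. u n \<bullet> v n" .

lift_definition norm_ell2 :: "'a ell2 \<Rightarrow> real" is "\<lambda>u. sqrt (\<Sum>\<^sub>\<infinity>n. (cmod (u n))\<^sup>2)" .

definition sgn_ell2 :: "'a ell2 \<Rightarrow> 'a ell2"
  where "sgn_ell2 u = u /\<^sub>R norm u"

definition dist_ell2 :: "'a ell2 \<Rightarrow> 'a ell2 \<Rightarrow> real"
  where "dist_ell2 u v = norm (u - v)"

definition uniformity_ell2 :: "('a ell2 \<times> 'a ell2) filter"
  where "uniformity_ell2 = (INF e\<in>{0<..}. principal {(u, v). dist u v < e})"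

definition open_ell2 :: "'a ell2 set \<Rightarrow> bool"
  where "open_ell2 U \<longleftrightarrow> (\<forall>u\<in>U. eventually (\<lambda>(u', v). u' = u \<longrightarrow> v \<in> U) uniformity)"

instance
proof
  fix x y z :: "'a ell2" and r :: real
  show "sgn x = x /\<^sub>R norm x" by (rule sgn_ell2_def)
  show "dist x y = norm (x - y)" by (rule dist_ell2_def)
  show "uniformity = (INF e\<in>{0<..}. principal {(u, v :: 'a ell2). dist u v < e})"
    by (rule uniformity_ell2_def)
  show "open U \<longleftrightarrow> (\<forall>u\<in>U. eventually (\<lambda>(u', v). u' = u \<longrightarrow> v \<in> U) uniformity)"
    for U :: "'a ell2 set"
    by (rule open_ell2_def)
  show "x \<bullet> y = y \<bullet> x" by transfer (simp add: inner_commute)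
  show "(x + y) \<bullet> z = x \<bullet> z + y \<bullet> z"
    by transfer (simp add: inner_add_left infsum_add ell2_inner_summable)
  show "(r *\<^sub>R x) \<bullet> y = r * (x \<bullet> y)"
  proof transfer
    fix r :: real and x y :: "'a \<Rightarrow> complex"
    have "(\<lambda>n. (of_real r * x n) \<bullet> y n) = (\<lambda>n. r * (x n \<bullet> y n))"
      by (simp add: flip: scaleR_conv_of_real)
    then show "(\<Sum>\<^sub>\<infinity>n. (of_real r * x n) \<bullet> y n) = r * (\<Sum>\<^sub>\<infinity>n. x n \<bullet> y n)"
      by (simp only: infsum_cmult_right')
  qed
  show "0 \<le> x \<bullet> x" by transfer (simp add: infsum_nonneg)
  show "x \<bullet> x = 0 \<longleftrightarrow> x = 0"
  proof transfer
    fix u :: "'a \<Rightarrow> complex"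
    assume u: "(\<lambda>n. (cmod (u n))\<^sup>2) summable_on UNIV"
    have "u = (\<lambda>_. 0)" if "(\<Sum>\<^sub>\<infinity>n. u n \<bullet> u n) = 0"
    proof
      fix n
      have "(cmod (u n))\<^sup>2 = 0"
        by (rule nonneg_infsum_le_0D[of "\<lambda>n. (cmod (u n))\<^sup>2" UNIV n])
           (use u that in \<open>simp_all only: dot_square_norm, simp_all\<close>)
      then show "u n = 0" by simp
    qed
    then show "(\<Sum>\<^sub>\<infinity>n. u n \<bullet> u n) = 0 \<longleftrightarrow> u = (\<lambda>_. 0)"
      by (intro iffI) simp_all
  qed
  show "norm x = sqrt (x \<bullet> x)" by transfer (simp add: dot_square_norm)
qed

end

definition bounded_clinear_ell2 :: "('i ell2 \<Rightarrow> 'i ell2) \<Rightarrow> bool"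
  where "bounded_clinear_ell2 A \<longleftrightarrow>
    bounded_linear A \<and> (\<forall>z u. A (z *\<^sub>C u) = z *\<^sub>C A u)"

definition spectrum_ell2 :: "('i ell2 \<Rightarrow> 'i ell2) \<Rightarrow> complex set"
  where "spectrum_ell2 A = {z. \<not> (\<exists>B. bounded_clinear_ell2 B \<and>
    B \<circ> (\<lambda>u. z *\<^sub>C u - A u) = id \<and> (\<lambda>u. z *\<^sub>C u - A u) \<circ> B = id)}"

definition resolvent_ell2 :: "('i ell2 \<Rightarrow> 'i ell2) \<Rightarrow> complex \<Rightarrow> 'i ell2 \<Rightarrow> 'i ell2"
  where "resolvent_ell2 A z = inv (\<lambda>u. z *\<^sub>C u - A u)"

(* Intended for \<epsilon> \<ge> 0; the case distinction is needed since inverse 0 = 0. *)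
definition pseudospectrum_ell2 :: "real \<Rightarrow> ('i ell2 \<Rightarrow> 'i ell2) \<Rightarrow> complex set"
  where "pseudospectrum_ell2 \<epsilon> A =
    (if \<epsilon> > 0
     then spectrum_ell2 A \<union> {z. z \<notin> spectrum_ell2 A \<and> onorm (resolvent_ell2 A z) \<ge> inverse \<epsilon>}
     else spectrum_ell2 A)"

definition jacobi :: "(int \<Rightarrow> real) \<Rightarrow> (int \<Rightarrow> real) \<Rightarrow> (int \<Rightarrow> real) \<Rightarrow> int ell2 \<Rightarrow> int ell2"
  where "jacobi a b c u = Abs_ell2 (\<lambda>n.
    of_real (c (n - 1)) * ell2_nth u (n - 1) + of_real (a n) * ell2_nth u n
      + of_real (b n) * ell2_nth u (n + 1))"

definition periodic_seq :: "nat \<Rightarrow> (int \<Rightarrow> real) \<Rightarrow> bool"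
  where "periodic_seq p a \<longleftrightarrow> (\<forall>i. a (i + int p) = a i)"

(* The set is finite for periodic sequences, see below, so Max is meaningful. *)
definition osc0 :: "(int \<Rightarrow> real) \<Rightarrow> real"
  where "osc0 a = Max {\<bar>a i - a 0\<bar> | i. i \<ge> 0}"

lemma periodic_seq_mod:
  assumes "periodic_seq p a"
  shows "a (i mod int p) = a i"
proof -
  have *: "a (i + int k * int p) = a i" for i k
  proof (induction k)
    case (Suc k)
    have "a (i + int (Suc k) * int p) = a ((i + int k * int p) + int p)"
      by (simp add: algebra_simps)
    also have "\<dots> = a (i + int k * int p)"
      using assms unfolding periodic_seq_def by blast
    finally show ?case using Suc by simp
  qed simp
  have "a (j + k * int p) = a j" for j k
  proof (cases "k \<ge> 0")
    case True
    then show ?thesis using *[of j "nat k"] by simp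
  next
    case False
    then show ?thesis using *[of "j + k * int p" "nat (- k)"] by simp
  qed
  from this[of "i mod int p" "i div int p"] show ?thesis by simp
qed

lemma periodic_seq_finite_range:
  assumes "p \<ge> 1" "periodic_seq p a"
  shows "finite (range a)"
proof -
  have "range a \<subseteq> a ` {0..<int p}"
  proof
    fix x assume "x \<in> range a"
    then obtain i where "x = a i" by auto
    then have "x = a (i mod int p)" by (simp add: periodic_seq_mod[OF assms(2)])
    moreover have "i mod int p \<in> {0..<int p}" using assms(1) by simp
    ultimately show "x \<in> a ` {0..<int p}" by blast
  qed
  then show ?thesis by (rule finite_subset) simp
qed

lemma finite_osc0:
  assumes "p \<ge> 1" "periodic_seq p a"
  shows "finite {\<bar>a i - a 0\<bar> | i. i \<ge> 0}"
  by (rule finite_subset[of _ "(\<lambda>x. \<bar>x - a 0\<bar>) ` range a"])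
     (auto simp: periodic_seq_finite_range[OF assms])

lemma ell2_bounded_mult_shift_mem:
  assumes "finite (range (w :: int \<Rightarrow> real))"
  shows "(\<lambda>n. (cmod (of_real (w (n + l)) * ell2_nth u (n + k)))\<^sup>2) summable_on UNIV"
proof -
  obtain C where C: "\<And>i. \<bar>w i\<bar> \<le> C"
    using finite_imp_bounded[OF assms] by (auto simp: bounded_iff)
  have "(\<lambda>n. (cmod (ell2_nth u n))\<^sup>2) summable_on UNIV"
    using ell2_nth[of u] by simp
  then have "((\<lambda>n. (cmod (ell2_nth u n))\<^sup>2) \<circ> (\<lambda>n. n + k)) summable_on UNIV"
    using summable_on_reindex[of "\<lambda>n. n + k" UNIV "\<lambda>n. (cmod (ell2_nth u n))\<^sup>2"]
    by simp
  then have *: "(\<lambda>n. C\<^sup>2 * (cmod (ell2_nth u (n + k)))\<^sup>2) summable_on UNIV"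
    by (intro summable_on_cmult_right) (simp add: o_def)
  show ?thesis
  proof (rule summable_on_comparison_test[OF *])
    fix n
    have "\<bar>w (n + l)\<bar>\<^sup>2 \<le> C\<^sup>2" by (intro power_mono C) auto
    then show "(cmod (of_real (w (n + l)) * ell2_nth u (n + k)))\<^sup>2 \<le> C\<^sup>2 * (cmod (ell2_nth u (n + k)))\<^sup>2"
      by (auto simp: norm_mult power_mult_distrib intro: mult_right_mono)
  qed auto
qed

(* For periodic coefficients the argument of Abs_ell2 in the definition of jacobi
   is square-summable, so jacobi really is the operator given by the tridiagonal matrix. *)
lemma jacobi_nth:
  assumes "p \<ge> 1" "periodic_seq p a" "periodic_seq p b" "periodic_seq p c"
  shows "ell2_nth (jacobi a b c u) n =
    of_real (c (n - 1)) * ell2_nth u (n - 1) + of_real (a n) * ell2_nth u n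
      + of_real (b n) * ell2_nth u (n + 1)"
proof -
  note fin = assms(2-4)[THEN periodic_seq_finite_range[OF assms(1)]]
  have "(\<lambda>n. (cmod (of_real (c (n - 1)) * ell2_nth u (n - 1) + of_real (a n) * ell2_nth u n
      + of_real (b n) * ell2_nth u (n + 1)))\<^sup>2) summable_on UNIV"
    using ell2_bounded_mult_shift_mem[OF fin(1), of 0 u 0]
      ell2_bounded_mult_shift_mem[OF fin(2), of 0 u 1]
      ell2_bounded_mult_shift_mem[OF fin(3), of "-1" u "-1"]
    by (intro ell2_add_mem) simp_all
  then show ?thesis
    by (simp add: jacobi_def Abs_ell2_inverse)
qed

end

(* If p = 1 or all deviations vanish, then r = 0 and J is a Laurent operator, whose spectrum is the
   image of the unit circle under its symbol.

   Otherwise compare J with the self-adjoint Laurent operator L with coefficients a_0, b_0, b_0, whose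
   spectrum is a segment K; by Cauchy-Schwarz \<parallel>J - L\<parallel> < r. Approximate eigenvectors of L put K inside
   the pseudospectrum, and the numerical range of L shows that every frontier point of the spectrum of
   J lies within r of K, hence is joined to K inside a disc of radius r about a spectral point. It
   remains to join an arbitrary point z of the pseudospectrum to the frontier of the spectrum. Off the
   spectrum there is a holomorphic f with |f| \<le> \<parallel>R\<parallel> and equality at z. The open mapping behaviour of
   f at z gives a path from z into {|f| > 1/r}, and by the maximum modulus principle the component of
   that open set so reached must accumulate at the spectrum. *)

theory Submission
  imports Defs "HOL-Complex_Analysis.Complex_Analysis"
begin

section \<open>The Hilbert space of square-summable families\<close>

text \<open>L carries b_0 on both off-diagonals, whatever J has there: this makes L symmetric, so
  its quadratic form is real and fills at most a segment, and it is why c is measured against b_0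
  and not against c_0. J itself need not be normal, and interior points of the spectrum of a
  non-normal operator may lack approximate eigenvectors. Frontier points always have them, and to
  these vectors the quadratic form of L can be applied; hence the detour through the frontier. Let Q
  be the sum of the three squared deviations. The deviations add up to at most sqrt (3 Q), whereas p
  >= 2 gives r >= 3 sqrt Q, strictly more when Q > 0. This slack absorbs the errors of the
  approximate eigenvectors. Off the spectrum the pseudospectrum is only relatively closed, and
  connectedness of such a set does not yield paths. A modulus |f| that touches the resolvent norm
  from below at z gives an open subset {|f| > 1/r}, whose components are path-connected.\<close>

lemmas ell2_nth_simps [simp] =
  zero_ell2.rep_eq plus_ell2.rep_eq minus_ell2.rep_eq uminus_ell2.rep_eq
  scaleR_ell2.rep_eq cscale_ell2.rep_eq

lemma ell2_eqI: "(\<And>n. ell2_nth u n = ell2_nth v n) \<Longrightarrow> u = v"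
  by (simp add: ell2_nth_inject[symmetric] fun_eq_iff)

lemma ell2_nth_summable: "(\<lambda>n. (cmod (ell2_nth u n))\<^sup>2) summable_on UNIV"
  using ell2_nth[of u] by simp

lemma norm_ell2_power2: "(norm u)\<^sup>2 = (\<Sum>\<^sub>\<infinity>n. (cmod (ell2_nth u n))\<^sup>2)"
  by (simp add: norm_ell2.rep_eq infsum_nonneg)

lemma cscale_add_right: "z *\<^sub>C (u + v) = z *\<^sub>C u + z *\<^sub>C v"
  and cscale_diff_right: "z *\<^sub>C (u - v) = z *\<^sub>C u - z *\<^sub>C v"
  and cscale_minus_right: "z *\<^sub>C (- u) = - (z *\<^sub>C u)"
  and cscale_add_left: "(z + w) *\<^sub>C u = z *\<^sub>C u + w *\<^sub>C u"
  and cscale_diff_left: "(z - w) *\<^sub>C u = z *\<^sub>C u - w *\<^sub>C u"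
  and cscale_minus_left: "(- z) *\<^sub>C u = - (z *\<^sub>C u)"
  by (auto intro!: ell2_eqI simp: algebra_simps)

lemmas cscale_distribs = cscale_add_right cscale_diff_right cscale_minus_right
  cscale_add_left cscale_diff_left cscale_minus_left

lemma cscale_cscale [simp]: "z *\<^sub>C w *\<^sub>C u = (z * w) *\<^sub>C u"
  and cscale_one [simp]: "1 *\<^sub>C u = u"
  and cscale_zero_left [simp]: "0 *\<^sub>C u = 0"
  and cscale_zero_right [simp]: "z *\<^sub>C 0 = 0"
  by (auto intro!: ell2_eqI)

lemma scaleR_conv_cscale: "x *\<^sub>R u = of_real x *\<^sub>C u"
  by (auto intro!: ell2_eqI)

lemma norm_cscale [simp]: "norm (z *\<^sub>C u) = cmod z * norm u"
  by (simp add: norm_ell2.rep_eq norm_mult power_mult_distrib infsum_cmult_right' real_sqrt_mult)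

lemma norm_nth_le: "cmod (ell2_nth u n) \<le> norm u"
proof -
  have "(\<Sum>k\<in>{n}. (cmod (ell2_nth u k))\<^sup>2) \<le> (norm u)\<^sup>2"
    unfolding norm_ell2_power2
    by (rule finite_sum_le_infsum[OF ell2_nth_summable]) auto
  then show ?thesis
    by (simp add: power2_le_iff_abs_le)
qed

text \<open>Completeness is what lets inverses be built by the Banach fixed point theorem. Each
  coordinate is dominated by the norm, so coordinates converge; Cauchy bounds on finite partial sums
  survive this limit and then bound the infinite sum.\<close>

instance ell2 :: (type) banach
proof
  fix X :: "nat \<Rightarrow> 'a ell2"
  assume X: "Cauchy X"
  have "Cauchy (\<lambda>k. ell2_nth (X k) n)" for n
  proof (rule metric_CauchyI)
    fix e :: real assume "e > 0"
    then obtain M where M: "\<forall>m\<ge>M. \<forall>k\<ge>M. dist (X m) (X k) < e"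
      using X unfolding Cauchy_def by meson
    have "dist (ell2_nth (X m) n) (ell2_nth (X k) n) \<le> dist (X m) (X k)" for m k
      using norm_nth_le[of "X m - X k" n] by (simp add: dist_norm)
    then show "\<exists>M. \<forall>m\<ge>M. \<forall>k\<ge>M. dist (ell2_nth (X m) n) (ell2_nth (X k) n) < e"
      using M by (meson le_less_trans)
  qed
  then have "\<exists>x. \<forall>n. (\<lambda>k. ell2_nth (X k) n) \<longlonglongrightarrow> x n"
    unfolding Cauchy_convergent_iff convergent_def by metis
  then obtain x where x: "\<And>n. (\<lambda>k. ell2_nth (X k) n) \<longlonglongrightarrow> x n"
    by blast
  have fin: "(\<Sum>n\<in>F. (cmod (ell2_nth (X m) n - x n))\<^sup>2) \<le> e\<^sup>2"
    if "finite F" and M: "\<And>k. k \<ge> M \<Longrightarrow> dist (X m) (X k) \<le> e" for F m M e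
  proof (rule tendsto_upperbound)
    show "(\<lambda>k. \<Sum>n\<in>F. (cmod (ell2_nth (X m) n - ell2_nth (X k) n))\<^sup>2)
        \<longlonglongrightarrow> (\<Sum>n\<in>F. (cmod (ell2_nth (X m) n - x n))\<^sup>2)"
      by (intro tendsto_intros x)
    have "(\<Sum>n\<in>F. (cmod (ell2_nth (X m) n - ell2_nth (X k) n))\<^sup>2) \<le> e\<^sup>2" if "k \<ge> M" for k
    proof -
      have "(\<Sum>n\<in>F. (cmod (ell2_nth (X m - X k) n))\<^sup>2) \<le> (norm (X m - X k))\<^sup>2"
        unfolding norm_ell2_power2
        by (rule finite_sum_le_infsum[OF ell2_nth_summable]) (use \<open>finite F\<close> in auto)
      also have "\<dots> \<le> e\<^sup>2"
        using M[OF that] by (intro power_mono) (auto simp: dist_norm)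
      finally show ?thesis by simp
    qed
    then show "\<forall>\<^sub>F k in sequentially. (\<Sum>n\<in>F. (cmod (ell2_nth (X m) n - ell2_nth (X k) n))\<^sup>2) \<le> e\<^sup>2"
      by (auto simp: eventually_sequentially)
  qed simp
  have tail: "(\<lambda>n. (cmod (ell2_nth (X m) n - x n))\<^sup>2) summable_on UNIV"
      "(\<Sum>\<^sub>\<infinity>n. (cmod (ell2_nth (X m) n - x n))\<^sup>2) \<le> e\<^sup>2"
    if "\<And>k. k \<ge> M \<Longrightarrow> dist (X m) (X k) \<le> e" for m M e
  proof -
    show s: "(\<lambda>n. (cmod (ell2_nth (X m) n - x n))\<^sup>2) summable_on UNIV"
      using fin[OF _ that] by (intro nonneg_bdd_above_summable_on) (auto intro!: bdd_aboveI)
    show "(\<Sum>\<^sub>\<infinity>n. (cmod (ell2_nth (X m) n - x n))\<^sup>2) \<le> e\<^sup>2"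
      using fin[OF _ that] by (intro infsum_le_finite_sums s) auto
  qed
  obtain M where M: "\<forall>m\<ge>M. \<forall>k\<ge>M. dist (X m) (X k) < 1"
    using X unfolding Cauchy_def by (meson zero_less_one)
  \<comment> \<open>The limit is one member of the sequence minus its square-summable error, hence
    square-summable.\<close>
  have "(\<lambda>n. (cmod (ell2_nth (X M) n + - (ell2_nth (X M) n - x n)))\<^sup>2) summable_on UNIV"
  proof (rule ell2_add_mem[OF ell2_nth_summable])
    show "(\<lambda>n. (cmod (- (ell2_nth (X M) n - x n)))\<^sup>2) summable_on UNIV"
      using tail(1)[of M M 1] M by (simp add: less_imp_le norm_minus_commute)
  qed
  then have nth: "ell2_nth (Abs_ell2 x) = x"
    by (simp add: Abs_ell2_inverse)
  have "X \<longlonglongrightarrow> Abs_ell2 x"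
  proof (rule LIMSEQ_I)
    fix e :: real assume "e > 0"
    then obtain M where M: "\<forall>m\<ge>M. \<forall>k\<ge>M. dist (X m) (X k) < e/2"
      using X unfolding Cauchy_def by (meson half_gt_zero)
    have "norm (X m - Abs_ell2 x) < e" if "m \<ge> M" for m
    proof -
      have "(norm (X m - Abs_ell2 x))\<^sup>2 \<le> (e/2)\<^sup>2"
        unfolding norm_ell2_power2 using tail(2)[of M m "e/2"] M that
        by (simp add: nth less_imp_le)
      then have "norm (X m - Abs_ell2 x) \<le> e/2"
        by (rule power2_le_imp_le) (use \<open>e > 0\<close> in simp)
      then show ?thesis using \<open>e > 0\<close> by simp
    qed
    then show "\<exists>no. \<forall>n\<ge>no. norm (X n - Abs_ell2 x) < e" by blast
  qed
  then show "convergent X" by (rule convergentI)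
qed

text \<open>The real part of the complex inner product is the given real one; its imaginary part is
  forced by linearity in the first argument.\<close>

definition cinner_ell2 :: "'i ell2 \<Rightarrow> 'i ell2 \<Rightarrow> complex"
  where "cinner_ell2 u v = Complex (u \<bullet> v) (((- \<i>) *\<^sub>C u) \<bullet> v)"

lemma cinner_add_left: "cinner_ell2 (u + v) w = cinner_ell2 u w + cinner_ell2 v w"
  and cinner_diff_left: "cinner_ell2 (u - v) w = cinner_ell2 u w - cinner_ell2 v w"
  by (simp_all add: cinner_ell2_def cscale_distribs inner_distrib inner_diff_left complex_eq_iff)

lemma cinner_cscale_left: "cinner_ell2 (z *\<^sub>C u) v = z * cinner_ell2 u v"
proof -
  have z: "z *\<^sub>C u = Re z *\<^sub>R u + Im z *\<^sub>R \<i> *\<^sub>C u" for u :: "'a ell2"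
    by (rule ell2_eqI) (simp add: complex_eq_iff)
  have "cinner_ell2 (\<i> *\<^sub>C u) v = \<i> * cinner_ell2 u v"
    by (simp add: cinner_ell2_def complex_eq_iff cscale_minus_left)
  moreover have "cinner_ell2 (x *\<^sub>R u) v = x *\<^sub>R cinner_ell2 u v" for x u
  proof -
    have "(- \<i>) *\<^sub>C x *\<^sub>R u = x *\<^sub>R (- \<i>) *\<^sub>C u"
      by (simp add: scaleR_conv_cscale mult.commute)
    then show ?thesis
      by (simp add: cinner_ell2_def complex_eq_iff)
  qed
  ultimately have "cinner_ell2 (z *\<^sub>C u) v = Re z *\<^sub>R cinner_ell2 u v + Im z *\<^sub>R (\<i> * cinner_ell2 u v)"
    by (subst z) (simp only: cinner_add_left)
  then show ?thesis
    by (simp add: complex_eq_iff)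
qed

lemma cinner_commute: "cinner_ell2 u v = cnj (cinner_ell2 v u)"
proof -
  have "Im (cinner_ell2 u v) = - Im (cinner_ell2 v u)"
  proof -
    have "(((- \<i>) *\<^sub>C u) \<bullet> v) = - (((- \<i>) *\<^sub>C v) \<bullet> u)"
    proof (transfer)
      fix u v :: "'a \<Rightarrow> complex"
      have "(- \<i> * u n) \<bullet> v n = - ((- \<i> * v n) \<bullet> u n)" for n
        by (simp add: inner_complex_def)
      then show "(\<Sum>\<^sub>\<infinity>n. (- \<i> * u n) \<bullet> v n) = - (\<Sum>\<^sub>\<infinity>n. (- \<i> * v n) \<bullet> u n)"
        by (simp add: infsum_uminus)
    qed
    then show ?thesis by (simp add: cinner_ell2_def)
  qed
  then show ?thesis by (simp add: complex_eq_iff cinner_ell2_def inner_commute)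
qed

lemma cinner_self: "cinner_ell2 u u = of_real ((norm u)\<^sup>2)"
proof -
  have "Im (cinner_ell2 u u) = 0"
    using cinner_commute[of u u] by (simp add: complex_eq_iff)
  then show ?thesis
    by (simp add: complex_eq_iff cinner_ell2_def power2_norm_eq_inner)
qed

text \<open>Rotating \<open>u\<close> by a unimodular factor turns the complex product into its
  modulus, so the real Cauchy-Schwarz inequality applies.\<close>

lemma norm_cinner_le: "cmod (cinner_ell2 u v) \<le> norm u * norm v"
proof (cases "cinner_ell2 u v = 0")
  case False
  define z where "z = cnj (sgn (cinner_ell2 u v))"
  have "cinner_ell2 (z *\<^sub>C u) v = of_real (cmod (cinner_ell2 u v))"
    by (simp add: cinner_cscale_left z_def sgn_eq complex_eq_iff cmod_def power2_eq_square
        add_divide_distrib[symmetric] real_div_sqrt)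
  then have "cmod (cinner_ell2 u v) = (z *\<^sub>C u) \<bullet> v"
    by (metis cinner_ell2_def Re_complex_of_real complex.sel(1))
  also have "\<dots> \<le> norm (z *\<^sub>C u) * norm v"
    by (rule norm_cauchy_schwarz)
  also have "\<dots> = norm u * norm v"
    using False by (simp add: z_def norm_sgn)
  finally show ?thesis .
qed simp

section \<open>Bounded operators and resolvents\<close>

definition invertible_ell2 :: "('i ell2 \<Rightarrow> 'i ell2) \<Rightarrow> bool"
  where "invertible_ell2 T \<longleftrightarrow> (\<exists>B. bounded_clinear_ell2 B \<and> B \<circ> T = id \<and> T \<circ> B = id)"

lemma spectrum_iff: "z \<in> spectrum_ell2 A \<longleftrightarrow> \<not> invertible_ell2 (\<lambda>u. z *\<^sub>C u - A u)"
  by (simp add: spectrum_ell2_def invertible_ell2_def)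

lemma bounded_clinear_ell2I:
  assumes "\<And>u v. A (u + v) = A u + A v" "\<And>z u. A (z *\<^sub>C u) = z *\<^sub>C A u"
    and "\<And>u. norm (A u) \<le> C * norm u"
  shows "bounded_clinear_ell2 A"
  unfolding bounded_clinear_ell2_def
  using assms by (auto intro!: bounded_linear_intro[of _ C] simp: scaleR_conv_cscale mult.commute)

lemma bounded_clinear_ell2D:
  assumes "bounded_clinear_ell2 A"
  shows "bounded_linear A" "A (z *\<^sub>C u) = z *\<^sub>C A u"
    "A (u + v) = A u + A v" "A (u - v) = A u - A v" "A 0 = 0" "norm (A u) \<le> onorm A * norm u"
  using assms linear_simps[of A] onorm[of A u] by (auto simp: bounded_clinear_ell2_def)

lemma bounded_clinear_compose:
  assumes "bounded_clinear_ell2 A" "bounded_clinear_ell2 B"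
  shows "bounded_clinear_ell2 (A \<circ> B)"
  using assms bounded_linear_compose[of A B] by (auto simp: bounded_clinear_ell2_def o_def)

lemma bounded_clinear_cscale: "bounded_clinear_ell2 (\<lambda>u. z *\<^sub>C u)"
  by (rule bounded_clinear_ell2I[where C = "cmod z"]) (auto simp: cscale_distribs mult.commute)

lemma bounded_clinear_add:
  assumes "bounded_clinear_ell2 A" "bounded_clinear_ell2 B"
  shows "bounded_clinear_ell2 (\<lambda>u. A u + B u)"
  using assms bounded_linear_add[of A B] by (auto simp: bounded_clinear_ell2_def cscale_distribs)

lemma invertible_compose:
  assumes "invertible_ell2 S" "invertible_ell2 T"
  shows "invertible_ell2 (S \<circ> T)"
proof -
  obtain B C where "bounded_clinear_ell2 B" "B \<circ> S = id" "S \<circ> B = id"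
      "bounded_clinear_ell2 C" "C \<circ> T = id" "T \<circ> C = id"
    using assms unfolding invertible_ell2_def by auto
  then show ?thesis
    unfolding invertible_ell2_def
    by (intro exI[of _ "C \<circ> B"]) (auto simp: bounded_clinear_compose fun_eq_iff)
qed

lemma invertible_cscale: "z \<noteq> 0 \<Longrightarrow> invertible_ell2 (\<lambda>u. z *\<^sub>C u)"
  unfolding invertible_ell2_def
  by (rule exI[of _ "\<lambda>u. inverse z *\<^sub>C u"]) (auto simp: bounded_clinear_cscale)

text \<open>Solving \<open>u + F u = v\<close> amounts to finding the fixed point of the contraction
  \<open>u \<mapsto> v - F u\<close>.\<close>

lemma invertible_id_plus_contraction:
  fixes F :: "'i ell2 \<Rightarrow> 'i ell2"
  assumes F: "bounded_clinear_ell2 F" and k: "\<And>u. norm (F u) \<le> k * norm u" "0 \<le> k" "k < 1"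
  shows "invertible_ell2 (\<lambda>u. u + F u)"
proof -
  note F' = bounded_clinear_ell2D[OF F]
  have "\<exists>!u. v - F u = u" for v
  proof (rule banach_fix_type[OF k(2,3)], intro allI)
    fix x y
    show "dist (v - F x) (v - F y) \<le> k * dist x y"
      using k(1)[of "y - x"] by (simp add: dist_norm F'(4) norm_minus_commute)
  qed
  moreover have "v - F u = u \<longleftrightarrow> u + F u = v" for u v
    by (auto simp: algebra_simps)
  ultimately have "\<exists>!u. u + F u = v" for v
    by simp
  then obtain B where B: "B v + F (B v) = v" and uniq: "u + F u = v \<Longrightarrow> u = B v" for u v
    by metis
  have "(1 - k) * norm (B v) \<le> norm v" for v
    using norm_diff_ineq[of "B v" "F (B v)"] k(1)[of "B v"] B[of v] by (simp add: algebra_simps)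
  then have bd: "norm (B v) \<le> 1 / (1 - k) * norm v" for v
    using k(3) by (simp add: field_simps)
  have "bounded_clinear_ell2 B"
  proof (rule bounded_clinear_ell2I[OF _ _ bd])
    fix u v z
    show "B (u + v) = B u + B v"
      using B[of u] B[of v] by (intro uniq[symmetric]) (simp add: F' algebra_simps)
    show "B (z *\<^sub>C u) = z *\<^sub>C B u"
      using B[of u] by (intro uniq[symmetric]) (simp add: F' flip: cscale_add_right)
  qed
  then show ?thesis
    unfolding invertible_ell2_def using B uniq by (intro exI[of _ B]) (auto simp: fun_eq_iff)
qed

lemma resolvent_facts:
  assumes "z \<notin> spectrum_ell2 A"
  shows bounded_clinear_resolvent: "bounded_clinear_ell2 (resolvent_ell2 A z)"
    and resolvent_left: "resolvent_ell2 A z (z *\<^sub>C u - A u) = u"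
    and resolvent_right: "z *\<^sub>C resolvent_ell2 A z u - A (resolvent_ell2 A z u) = u"
proof -
  obtain B where B: "bounded_clinear_ell2 B" "B \<circ> (\<lambda>u. z *\<^sub>C u - A u) = id"
      "(\<lambda>u. z *\<^sub>C u - A u) \<circ> B = id"
    using assms unfolding spectrum_ell2_def by blast
  then have "resolvent_ell2 A z = B"
    unfolding resolvent_ell2_def by (intro inv_unique_comp)
  with B show "bounded_clinear_ell2 (resolvent_ell2 A z)"
    by simp
  from B \<open>resolvent_ell2 A z = B\<close> show "resolvent_ell2 A z (z *\<^sub>C u - A u) = u"
    "z *\<^sub>C resolvent_ell2 A z u - A (resolvent_ell2 A z u) = u"
    by (auto simp: fun_eq_iff)
qed

lemmas norm_resolvent_le = bounded_clinear_ell2D(6)[OF bounded_clinear_resolvent]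

lemma onorm_resolvent_le:
  assumes "z \<notin> spectrum_ell2 A" "c > 0" "\<And>u. c * norm u \<le> norm (z *\<^sub>C u - A u)"
  shows "onorm (resolvent_ell2 A z) \<le> 1 / c"
proof (rule onorm_bound)
  fix u
  show "norm (resolvent_ell2 A z u) \<le> 1 / c * norm u"
    using assms(3)[of "resolvent_ell2 A z u"] \<open>c > 0\<close>
    by (simp add: resolvent_right[OF assms(1)] field_simps)
qed (use \<open>c > 0\<close> in simp)

text \<open>Factor T + D = T (I + B D) with B the inverse of T; the second factor is the identity
  plus a contraction.\<close>

lemma invertible_perturb:
  assumes T: "bounded_clinear_ell2 B" "B \<circ> T = id" "T \<circ> B = id"
    and lin: "\<And>u v. T (u + v) = T u + T v"
    and D: "bounded_clinear_ell2 D" "onorm B * onorm D < 1"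
  shows "invertible_ell2 (\<lambda>u. T u + D u)"
proof -
  have "invertible_ell2 (\<lambda>u. u + (B \<circ> D) u)"
  proof (rule invertible_id_plus_contraction[where k = "onorm B * onorm D"])
    fix u
    have "norm (B (D u)) \<le> onorm B * norm (D u)"
      by (rule bounded_clinear_ell2D(6)[OF T(1)])
    also have "\<dots> \<le> onorm B * (onorm D * norm u)"
      using T D by (intro mult_left_mono bounded_clinear_ell2D(6) onorm_pos_le bounded_clinear_ell2D(1))
    finally show "norm ((B \<circ> D) u) \<le> onorm B * onorm D * norm u"
      by (simp add: mult.assoc)
  next
    show "0 \<le> onorm B * onorm D"
      using T D by (intro mult_nonneg_nonneg onorm_pos_le bounded_clinear_ell2D(1))
    show "bounded_clinear_ell2 (B \<circ> D)"
      by (rule bounded_clinear_compose[OF T(1) D(1)])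
  qed (rule D)
  moreover have "invertible_ell2 T"
    unfolding invertible_ell2_def by (intro exI[of _ B] conjI T)
  ultimately have "invertible_ell2 (T \<circ> (\<lambda>u. u + (B \<circ> D) u))"
    by (intro invertible_compose)
  moreover have "T \<circ> (\<lambda>u. u + (B \<circ> D) u) = (\<lambda>u. T u + D u)"
    using T(3) by (auto simp: fun_eq_iff lin)
  ultimately show ?thesis by simp
qed

section \<open>Spectrum, resolvent norm and pseudospectrum of one bounded operator\<close>

lemma onorm_cscale_le: "onorm (\<lambda>u :: 'i ell2. z *\<^sub>C u) \<le> cmod z"
  by (rule onorm_bound) auto

context
  fixes A :: "'i ell2 \<Rightarrow> 'i ell2"
  assumes A: "bounded_clinear_ell2 A"
begin

lemma notin_spectrum_perturb:
  assumes z: "z \<notin> spectrum_ell2 A" and w: "cmod (w - z) * onorm (resolvent_ell2 A z) < 1"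
  shows "w \<notin> spectrum_ell2 A"
proof -
  have "invertible_ell2 (\<lambda>u. (z *\<^sub>C u - A u) + (w - z) *\<^sub>C u)"
  proof (rule invertible_perturb[OF bounded_clinear_resolvent[OF z]])
    have "onorm (resolvent_ell2 A z) * onorm (\<lambda>u :: 'i ell2. (w - z) *\<^sub>C u)
        \<le> onorm (resolvent_ell2 A z) * cmod (w - z)"
      by (intro mult_left_mono onorm_cscale_le onorm_pos_le
          bounded_clinear_ell2D(1)[OF bounded_clinear_resolvent[OF z]])
    with w show "onorm (resolvent_ell2 A z) * onorm (\<lambda>u :: 'i ell2. (w - z) *\<^sub>C u) < 1"
      by (simp add: mult.commute)
    show "bounded_clinear_ell2 (\<lambda>u :: 'i ell2. (w - z) *\<^sub>C u)"
      by (rule bounded_clinear_cscale)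
  qed (auto simp: fun_eq_iff resolvent_left[OF z] resolvent_right[OF z] cscale_add_right
      bounded_clinear_ell2D[OF A])
  then show ?thesis
    by (simp add: spectrum_iff cscale_distribs)
qed

text \<open>Contrapositive of \<open>notin_spectrum_perturb\<close>: no spectral point lies in the
  open disc about \<open>z\<close> whose radius is the inverse of the resolvent norm.\<close>

lemma onorm_resolvent_ge:
  assumes "z \<notin> spectrum_ell2 A" "s \<in> spectrum_ell2 A"
  shows "onorm (resolvent_ell2 A z) \<ge> 1 / cmod (z - s)"
proof -
  have "z \<noteq> s" using assms by auto
  then show ?thesis
    using notin_spectrum_perturb[OF assms(1), of s] assms(2)
    by (auto simp: divide_simps norm_minus_commute mult.commute not_less[symmetric])
qed

lemma closed_spectrum: "closed (spectrum_ell2 A)"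
  unfolding closed_def open_contains_ball
proof
  fix z assume "z \<in> - spectrum_ell2 A"
  then have z: "z \<notin> spectrum_ell2 A" by simp
  define N where "N = onorm (resolvent_ell2 A z)"
  have N: "N \<ge> 0"
    unfolding N_def by (intro onorm_pos_le bounded_clinear_ell2D(1) bounded_clinear_resolvent z)
  \<comment> \<open>The added 1 spares a proof that \<open>N\<close> is positive.\<close>
  have "ball z (1 / (N + 1)) \<subseteq> - spectrum_ell2 A"
  proof
    fix w assume "w \<in> ball z (1 / (N + 1))"
    then have "cmod (w - z) * (N + 1) < 1"
      using N by (simp add: dist_norm norm_minus_commute field_simps)
    moreover have "cmod (w - z) * N \<le> cmod (w - z) * (N + 1)"
      by (intro mult_left_mono) auto
    ultimately show "w \<in> - spectrum_ell2 A"
      using notin_spectrum_perturb[OF z, of w] by (simp add: N_def)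
  qed
  then show "\<exists>e>0. ball z e \<subseteq> - spectrum_ell2 A"
    using N by (intro exI[of _ "1 / (N + 1)"]) auto
qed

lemma norm_shifted_ge: "(cmod z - onorm A) * norm u \<le> norm (z *\<^sub>C u - A u)"
  using norm_triangle_ineq2[of "z *\<^sub>C u" "A u"] bounded_clinear_ell2D(6)[OF A, of u]
  by (simp add: algebra_simps)

lemma spectrum_subset_cball: "spectrum_ell2 A \<subseteq> cball 0 (onorm A)"
proof
  fix z assume z: "z \<in> spectrum_ell2 A"
  show "z \<in> cball 0 (onorm A)"
  proof (rule ccontr)
    assume "z \<notin> cball 0 (onorm A)"
    then have less: "onorm A < cmod z" by simp
    have pos: "0 \<le> onorm A" by (intro onorm_pos_le bounded_clinear_ell2D(1) A)
    with less have z0: "z \<noteq> 0" by auto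
    define F where "F = (\<lambda>u. (- inverse z) *\<^sub>C A u)"
    have "invertible_ell2 (\<lambda>u. u + F u)"
    proof (rule invertible_id_plus_contraction)
      show "bounded_clinear_ell2 F"
        using bounded_clinear_compose[OF bounded_clinear_cscale A] by (simp add: F_def o_def)
      show "norm (F u) \<le> onorm A / cmod z * norm u" for u
        using bounded_clinear_ell2D(6)[OF A, of u] z0
        by (simp add: F_def norm_inverse norm_divide divide_simps mult.commute)
      show "0 \<le> onorm A / cmod z" using pos by simp
      show "onorm A / cmod z < 1" using less z0 by simp
    qed
    then have "invertible_ell2 ((\<lambda>u. z *\<^sub>C u) \<circ> (\<lambda>u. u + F u))"
      by (intro invertible_compose invertible_cscale z0)
    also have "(\<lambda>u. z *\<^sub>C u) \<circ> (\<lambda>u. u + F u) = (\<lambda>u. z *\<^sub>C u - A u)"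
      using z0 by (simp add: fun_eq_iff F_def cscale_distribs)
    finally show False using z by (simp add: spectrum_iff)
  qed
qed

lemma bounded_spectrum: "bounded (spectrum_ell2 A)"
  using bounded_subset[OF bounded_cball spectrum_subset_cball] .

lemma mem_pseudospectrum_iff:
  assumes "r > 0"
  shows "z \<in> pseudospectrum_ell2 r A \<longleftrightarrow>
    z \<in> spectrum_ell2 A \<or> onorm (resolvent_ell2 A z) \<ge> 1 / r"
  using assms by (auto simp: pseudospectrum_ell2_def inverse_eq_divide)

lemma bounded_pseudospectrum:
  assumes "r > 0"
  shows "bounded (pseudospectrum_ell2 r A)"
proof (rule bounded_subset[OF bounded_cball])
  show "pseudospectrum_ell2 r A \<subseteq> cball 0 (onorm A + r)"
  proof
    fix z assume z: "z \<in> pseudospectrum_ell2 r A"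
    show "z \<in> cball 0 (onorm A + r)"
    proof (rule ccontr)
      assume "z \<notin> cball 0 (onorm A + r)"
      then have less: "r < cmod z - onorm A" by simp
      with assms have "z \<notin> spectrum_ell2 A" using spectrum_subset_cball by auto
      moreover from this have "onorm (resolvent_ell2 A z) \<le> 1 / (cmod z - onorm A)"
        using less assms by (intro onorm_resolvent_le norm_shifted_ge) auto
      moreover have "1 / (cmod z - onorm A) < 1 / r"
        using less assms by (simp add: frac_less2)
      ultimately show False
        using z assms by (simp add: mem_pseudospectrum_iff)
    qed
  qed
qed

text \<open>These discs are convex, so they bridge any gap of length at most \<open>r\<close> that
  ends at a spectral point.\<close>

lemma cball_spectrum_subset_pseudospectrum:
  assumes "r > 0" "s \<in> spectrum_ell2 A"
  shows "cball s r \<subseteq> pseudospectrum_ell2 r A"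
proof
  fix z assume z: "z \<in> cball s r"
  show "z \<in> pseudospectrum_ell2 r A"
  proof (cases "z \<in> spectrum_ell2 A")
    case False
    then have "z \<noteq> s" using assms by auto
    have "1 / r \<le> 1 / cmod (z - s)"
      using z \<open>z \<noteq> s\<close> assms by (intro divide_left_mono) (auto simp: dist_norm norm_minus_commute)
    also have "\<dots> \<le> onorm (resolvent_ell2 A z)"
      by (rule onorm_resolvent_ge[OF False assms(2)])
    finally show ?thesis using assms by (simp add: mem_pseudospectrum_iff)
  qed (use assms in \<open>simp add: mem_pseudospectrum_iff\<close>)
qed

lemma approx_eigenvector_mem_pseudospectrum:
  assumes "r > 0" "u \<noteq> 0" "norm (z *\<^sub>C u - A u) \<le> r * norm u"
  shows "z \<in> pseudospectrum_ell2 r A"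
proof (cases "z \<in> spectrum_ell2 A")
  case False
  have pos: "0 \<le> onorm (resolvent_ell2 A z)"
    by (intro onorm_pos_le bounded_clinear_ell2D(1) bounded_clinear_resolvent False)
  have "norm u \<le> onorm (resolvent_ell2 A z) * norm (z *\<^sub>C u - A u)"
    using norm_resolvent_le[OF False, of "z *\<^sub>C u - A u"] by (simp add: resolvent_left[OF False])
  also have "\<dots> \<le> onorm (resolvent_ell2 A z) * (r * norm u)"
    by (intro mult_left_mono assms pos)
  finally have "1 \<le> onorm (resolvent_ell2 A z) * r"
    using assms(2) by (simp flip: mult.assoc)
  then show ?thesis
    using assms by (simp add: mem_pseudospectrum_iff field_simps)
qed (use assms in \<open>simp add: mem_pseudospectrum_iff\<close>)

lemma approx_eigenvectors_mem_spectrum: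
  assumes "\<And>\<delta>. \<delta> > 0 \<Longrightarrow> \<exists>u. u \<noteq> 0 \<and> norm (z *\<^sub>C u - A u) \<le> \<delta> * norm u"
  shows "z \<in> spectrum_ell2 A"
proof (rule ccontr)
  assume z: "z \<notin> spectrum_ell2 A"
  define N where "N = onorm (resolvent_ell2 A z)"
  have N: "0 \<le> N"
    unfolding N_def by (intro onorm_pos_le bounded_clinear_ell2D(1) bounded_clinear_resolvent z)
  obtain u where u: "u \<noteq> 0" "norm (z *\<^sub>C u - A u) \<le> 1 / (N + 1) * norm u"
    using assms[of "1 / (N + 1)"] N by auto
  have "norm u \<le> N * norm (z *\<^sub>C u - A u)"
    using norm_resolvent_le[OF z, of "z *\<^sub>C u - A u"] by (simp add: resolvent_left[OF z] N_def)
  also have "\<dots> \<le> N * (1 / (N + 1) * norm u)"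
    by (intro mult_left_mono u N)
  also have "\<dots> < norm u"
    using N u(1) by (simp add: field_simps)
  finally show False by simp
qed

text \<open>Points \<open>w\<close> off the spectrum approach \<open>s\<close>, and their resolvents
  blow up. The image under such a resolvent of a vector that it stretches strongly is an approximate
  eigenvector for \<open>w\<close>, and then for \<open>s\<close>.\<close>

lemma frontier_spectrum_approx_eigenvector:
  assumes s: "s \<in> frontier (spectrum_ell2 A)" and "\<delta> > 0"
  shows "\<exists>u. u \<noteq> 0 \<and> norm (s *\<^sub>C u - A u) \<le> \<delta> * norm u"
proof -
  have sp: "s \<in> spectrum_ell2 A"
    using s closed_spectrum frontier_subset_closed by blast
  \<comment> \<open>With e the distance from \<open>s\<close> to \<open>w\<close>, a vector
    attaining half of the lower bound 1/e for the resolvent norm costs 2e, and replacing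
    \<open>w\<close> by \<open>s\<close> costs another e; hence the third of \<delta>.\<close>
  obtain w where w: "w \<notin> spectrum_ell2 A" "dist s w < \<delta> / 3"
    using s \<open>\<delta> > 0\<close> unfolding frontier_straddle by (meson divide_pos_pos zero_less_numeral)
  have "s \<noteq> w" using sp w by auto
  define e where "e = dist s w"
  have e: "e > 0" "e < \<delta> / 3" using w \<open>s \<noteq> w\<close> by (auto simp: e_def)
  have "\<exists>u. norm (resolvent_ell2 A w u) > 1 / (2 * e) * norm u"
  proof (rule ccontr)
    assume "\<not> ?thesis"
    then have "onorm (resolvent_ell2 A w) \<le> 1 / (2 * e)"
      using e by (intro onorm_bound) (auto simp: not_less)
    moreover have "onorm (resolvent_ell2 A w) \<ge> 1 / e"
      using onorm_resolvent_ge[OF w(1) sp] by (simp add: e_def dist_norm norm_minus_commute)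
    ultimately show False using e by (simp add: field_simps)
  qed
  then obtain u where u: "norm (resolvent_ell2 A w u) > 1 / (2 * e) * norm u" by blast
  define x where "x = resolvent_ell2 A w u"
  have ux: "u = w *\<^sub>C x - A x" by (simp add: x_def resolvent_right[OF w(1)])
  have x: "norm (w *\<^sub>C x - A x) \<le> 2 * e * norm x"
    using u e by (simp add: ux[symmetric] x_def[symmetric] field_simps)
  have "norm x > 0"
    using u e by (intro le_less_trans[OF _ u[folded x_def]]) auto
  moreover have "norm (s *\<^sub>C x - A x) \<le> \<delta> * norm x"
  proof -
    have "norm (s *\<^sub>C x - A x) = norm ((w *\<^sub>C x - A x) + (s - w) *\<^sub>C x)"
      by (simp add: cscale_distribs)
    also have "\<dots> \<le> norm (w *\<^sub>C x - A x) + norm ((s - w) *\<^sub>C x)"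
      by (rule norm_triangle_ineq)
    also have "\<dots> \<le> 2 * e * norm x + e * norm x"
      using x by (simp add: e_def[symmetric] dist_norm[symmetric])
    also have "\<dots> = (3 * e) * norm x" by simp
    also have "\<dots> \<le> \<delta> * norm x"
      using e by (intro mult_right_mono) auto
    finally show ?thesis .
  qed
  ultimately show ?thesis by (intro exI[of _ x]) auto
qed

end

section \<open>Paths in the pseudospectrum\<close>

context
  fixes A :: "'i ell2 \<Rightarrow> 'i ell2"
  assumes A: "bounded_clinear_ell2 A"
begin

text \<open>The lower bound |x| / M for z - A loses at most half of itself when \<open>z\<close>
  moves by at most 1 / (2 M).\<close>

lemma resolvent_locally_bounded:
  assumes z: "z \<notin> spectrum_ell2 A"
  obtains e M where "e > 0" "M > 0"
    "\<And>w. w \<in> ball z e \<Longrightarrow> w \<notin> spectrum_ell2 A \<and> onorm (resolvent_ell2 A w) \<le> M"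
proof -
  define M where "M = onorm (resolvent_ell2 A z) + 1"
  have M: "M > 0"
    unfolding M_def
    by (intro add_nonneg_pos onorm_pos_le bounded_clinear_ell2D(1) bounded_clinear_resolvent z) auto
  have "w \<notin> spectrum_ell2 A \<and> onorm (resolvent_ell2 A w) \<le> 2 * M"
    if w: "w \<in> ball z (1 / (2 * M))" for w
  proof
    have w': "cmod (w - z) * M \<le> 1 / 2"
      using w M by (simp add: dist_norm norm_minus_commute field_simps)
    have "cmod (w - z) * onorm (resolvent_ell2 A z) \<le> cmod (w - z) * M"
      by (intro mult_left_mono) (auto simp: M_def)
    with w' show nw: "w \<notin> spectrum_ell2 A"
      by (intro notin_spectrum_perturb[OF A z]) simp
    have "1 / (2 * M) * norm x \<le> norm (w *\<^sub>C x - A x)" for x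
    proof -
      have "norm x \<le> onorm (resolvent_ell2 A z) * norm (z *\<^sub>C x - A x)"
        using norm_resolvent_le[OF z, of "z *\<^sub>C x - A x"] by (simp add: resolvent_left[OF z])
      also have "\<dots> \<le> M * norm (z *\<^sub>C x - A x)"
        by (intro mult_right_mono) (auto simp: M_def)
      also have "z *\<^sub>C x - A x = (w *\<^sub>C x - A x) - (w - z) *\<^sub>C x"
        by (simp add: cscale_distribs)
      also have "M * norm \<dots> \<le> M * (norm (w *\<^sub>C x - A x) + norm ((w - z) *\<^sub>C x))"
        using M by (intro mult_left_mono norm_triangle_ineq4) auto
      also have "\<dots> = M * norm (w *\<^sub>C x - A x) + (cmod (w - z) * M) * norm x"
        by (simp add: algebra_simps)
      also have "\<dots> \<le> M * norm (w *\<^sub>C x - A x) + 1 / 2 * norm x"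
        by (intro add_left_mono mult_right_mono w') auto
      finally show ?thesis
        using M by (simp add: field_simps)
    qed
    then show "onorm (resolvent_ell2 A w) \<le> 2 * M"
      using onorm_resolvent_le[OF nw, of "1 / (2 * M)"] M by simp
  qed
  with M show ?thesis
    by (intro that[of "1 / (2 * M)" "2 * M"]) auto
qed

text \<open>Supplies the uniform bounds on compact sets that Montel's theorem asks for.\<close>

lemma resolvent_bounded_on_compact:
  assumes "compact K" "K \<subseteq> - spectrum_ell2 A"
  obtains M where "\<And>w. w \<in> K \<Longrightarrow> onorm (resolvent_ell2 A w) \<le> M"
proof -
  have "\<forall>z\<in>K. \<exists>e M. e > 0 \<and> (\<forall>w\<in>ball z e. onorm (resolvent_ell2 A w) \<le> M)"
    using assms(2) by (meson ComplD resolvent_locally_bounded subsetD)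
  then obtain e M where e: "\<And>z. z \<in> K \<Longrightarrow> e z > 0"
      and M: "\<And>z w. z \<in> K \<Longrightarrow> w \<in> ball z (e z) \<Longrightarrow> onorm (resolvent_ell2 A w) \<le> M z"
    by metis
  have "K \<subseteq> (\<Union>z\<in>K. ball z (e z))" using e by auto
  then obtain C where C: "C \<subseteq> K" "finite C" "K \<subseteq> (\<Union>z\<in>C. ball z (e z))"
    using compactE_image[OF assms(1), of K "\<lambda>z. ball z (e z)"] by auto
  show ?thesis
  proof (rule that)
    fix w assume "w \<in> K"
    then obtain z where z: "z \<in> C" "w \<in> ball z (e z)" using C by auto
    then have "onorm (resolvent_ell2 A w) \<le> M z" using M C by blast
    also have "\<dots> \<le> Max (M ` C)" using z C by auto
    finally show "onorm (resolvent_ell2 A w) \<le> Max (M ` C)" .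
  qed
qed

lemma resolvent_identity:
  assumes "z \<notin> spectrum_ell2 A" "w \<notin> spectrum_ell2 A"
  shows "resolvent_ell2 A w u - resolvent_ell2 A z u
    = (z - w) *\<^sub>C resolvent_ell2 A w (resolvent_ell2 A z u)"
proof -
  define x where "x = resolvent_ell2 A z u"
  have u: "u = z *\<^sub>C x - A x" by (simp add: x_def resolvent_right[OF assms(1)])
  have "resolvent_ell2 A w u = resolvent_ell2 A w ((z - w) *\<^sub>C x + (w *\<^sub>C x - A x))"
    by (simp add: u cscale_distribs)
  also have "\<dots> = (z - w) *\<^sub>C resolvent_ell2 A w x + x"
    by (simp add: bounded_clinear_ell2D(2,3)[OF bounded_clinear_resolvent[OF assms(2)]]
        resolvent_left[OF assms(2)])
  finally show ?thesis by (simp add: x_def)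
qed

lemma resolvent_tendsto:
  assumes z: "z \<notin> spectrum_ell2 A"
  shows "((\<lambda>w. resolvent_ell2 A w x) \<longlongrightarrow> resolvent_ell2 A z x) (at z)"
proof -
  obtain e M where e: "e > 0" "M > 0"
      and M: "\<And>w. w \<in> ball z e \<Longrightarrow> w \<notin> spectrum_ell2 A \<and> onorm (resolvent_ell2 A w) \<le> M"
    using resolvent_locally_bounded[OF z] by blast
  have "((\<lambda>w. resolvent_ell2 A w x - resolvent_ell2 A z x) \<longlongrightarrow> 0) (at z)"
  proof (rule Lim_null_comparison)
    show "((\<lambda>w. cmod (z - w) * (M * norm (resolvent_ell2 A z x))) \<longlongrightarrow> 0) (at z)"
      by (rule tendsto_eq_intros refl | simp)+
    have "norm (resolvent_ell2 A w x - resolvent_ell2 A z x)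
        \<le> cmod (z - w) * (M * norm (resolvent_ell2 A z x))" if "w \<in> ball z e" for w
    proof -
      have w: "w \<notin> spectrum_ell2 A" using M that by blast
      have "norm (resolvent_ell2 A w (resolvent_ell2 A z x))
          \<le> onorm (resolvent_ell2 A w) * norm (resolvent_ell2 A z x)"
        by (rule norm_resolvent_le[OF w])
      also have "\<dots> \<le> M * norm (resolvent_ell2 A z x)"
        using M that by (intro mult_right_mono) auto
      finally show ?thesis
        unfolding resolvent_identity[OF z w] by (simp add: mult_left_mono)
    qed
    then show "\<forall>\<^sub>F w in at z. norm (resolvent_ell2 A w x - resolvent_ell2 A z x)
        \<le> cmod (z - w) * (M * norm (resolvent_ell2 A z x))"
      using e eventually_at_in_open'[of "ball z e" z] by (auto elim: eventually_mono)
  qed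
  then show ?thesis by (rule LIM_zero_cancel)
qed

lemma cinner_tendsto:
  assumes "(f \<longlongrightarrow> x) F"
  shows "((\<lambda>w. cinner_ell2 (f w) v) \<longlongrightarrow> cinner_ell2 x v) F"
proof -
  have "((\<lambda>w. cinner_ell2 (f w) v - cinner_ell2 x v) \<longlongrightarrow> 0) F"
  proof (rule Lim_null_comparison)
    show "((\<lambda>w. norm (f w - x) * norm v) \<longlongrightarrow> 0) F"
      by (rule tendsto_mult_left_zero[OF tendsto_norm_zero[OF LIM_zero[OF assms]]])
    show "\<forall>\<^sub>F w in F. norm (cinner_ell2 (f w) v - cinner_ell2 x v) \<le> norm (f w - x) * norm v"
      by (simp add: norm_cinner_le flip: cinner_diff_left)
  qed
  then show ?thesis by (rule LIM_zero_cancel)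
qed

text \<open>By the resolvent identity the difference quotient at z is minus the coefficient of R(w)
  R(z) u against v, so continuity of the resolvent on each fixed vector already gives a
  derivative.\<close>

lemma resolvent_coefficient_holomorphic:
  "(\<lambda>w. cinner_ell2 (resolvent_ell2 A w u) v) holomorphic_on - spectrum_ell2 A"
proof (rule holomorphic_onI)
  fix z assume "z \<in> - spectrum_ell2 A"
  then have z: "z \<notin> spectrum_ell2 A" by simp
  define x where "x = resolvent_ell2 A z u"
  have "((\<lambda>w. - cinner_ell2 (resolvent_ell2 A w x) v)
      \<longlongrightarrow> - cinner_ell2 (resolvent_ell2 A z x) v) (at z)"
    by (intro tendsto_minus cinner_tendsto resolvent_tendsto z)
  moreover have "\<forall>\<^sub>F w in at z. - cinner_ell2 (resolvent_ell2 A w x) v =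
      (cinner_ell2 (resolvent_ell2 A w u) v - cinner_ell2 (resolvent_ell2 A z u) v) / (w - z)"
  proof -
    have "\<forall>\<^sub>F w in at z. w \<in> - spectrum_ell2 A - {z}"
      using z closed_spectrum[OF A] by (intro eventually_at_in_open) auto
    then show ?thesis
    proof eventually_elim
      case (elim w)
      have "cinner_ell2 (resolvent_ell2 A w u) v - cinner_ell2 (resolvent_ell2 A z u) v
          = (z - w) * cinner_ell2 (resolvent_ell2 A w x) v"
        using resolvent_identity[OF z, of w u] elim
        by (simp add: x_def flip: cinner_diff_left cinner_cscale_left)
      then show ?case using elim by (simp add: field_simps)
    qed
  qed
  ultimately have "((\<lambda>w. (cinner_ell2 (resolvent_ell2 A w u) v - cinner_ell2 (resolvent_ell2 A z u) v)
      / (w - z)) \<longlongrightarrow> - cinner_ell2 (resolvent_ell2 A z x) v) (at z)"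
    by (rule Lim_transform_eventually)
  then have "((\<lambda>w. cinner_ell2 (resolvent_ell2 A w u) v) has_field_derivative
      - cinner_ell2 (resolvent_ell2 A z x) v) (at z)"
    by (simp add: has_field_derivative_iff)
  then show "(\<lambda>w. cinner_ell2 (resolvent_ell2 A w u) v) field_differentiable
      at z within - spectrum_ell2 A"
    using field_differentiable_def field_differentiable_at_within by blast
qed

text \<open>The resolvent norm at \<open>z\<close> need not be attained, so no single matrix coefficient has modulus
  \<open>\<parallel>R(z)\<parallel>\<close> there; a limit of matrix coefficients, extracted by Montel's theorem, does.\<close>

lemma norming_holomorphic_function:
  assumes z: "z \<notin> spectrum_ell2 A" and pos: "onorm (resolvent_ell2 A z) > 0"
  obtains f where "f holomorphic_on - spectrum_ell2 A"
    "\<And>w. w \<notin> spectrum_ell2 A \<Longrightarrow> cmod (f w) \<le> onorm (resolvent_ell2 A w)"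
    "cmod (f z) = onorm (resolvent_ell2 A z)"
proof -
  define N where "N = onorm (resolvent_ell2 A z)"
  \<comment> \<open>Starting the denominators at 2 keeps the lower bound positive for every
    \<open>k\<close>, as the use of \<open>onorm_bound\<close> requires.\<close>
  have "\<exists>u. norm u = 1 \<and> norm (resolvent_ell2 A z u) > N - N / real (k + 2)" for k :: nat
  proof -
    have c: "0 < N - N / real (k + 2)" "N - N / real (k + 2) < N"
      using pos by (simp_all add: N_def divide_less_eq)
    obtain x where x: "norm (resolvent_ell2 A z x) > (N - N / real (k + 2)) * norm x"
      using onorm_bound[of "N - N / real (k + 2)" "resolvent_ell2 A z"] c
      unfolding N_def by (meson less_le_not_le linorder_not_le)
    then have "x \<noteq> 0"
      by (auto simp: bounded_clinear_ell2D(5)[OF bounded_clinear_resolvent[OF z]])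
    define u where "u = of_real (inverse (norm x)) *\<^sub>C x"
    have "norm u = 1"
      using \<open>x \<noteq> 0\<close> by (simp add: u_def norm_inverse)
    moreover have "norm (resolvent_ell2 A z u) = inverse (norm x) * norm (resolvent_ell2 A z x)"
      by (simp add: u_def bounded_clinear_ell2D(2)[OF bounded_clinear_resolvent[OF z]] norm_inverse)
    then have "norm (resolvent_ell2 A z x) = norm (resolvent_ell2 A z u) * norm x"
      using \<open>x \<noteq> 0\<close> by simp
    with x have "N - N / real (k + 2) < norm (resolvent_ell2 A z u)"
      using \<open>x \<noteq> 0\<close> by (simp only: mult_less_cancel_right) simp
    ultimately show ?thesis by blast
  qed
  then obtain u where u: "\<And>k. norm (u k) = 1"
      "\<And>k. norm (resolvent_ell2 A z (u k)) > N - N / real (k + 2)"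
    by metis
  \<comment> \<open>Pairing with the normalised image makes the coefficient at \<open>z\<close> have
    modulus |R(z) u_k|, which tends to \<open>N\<close>.\<close>
  define v where "v k = of_real (inverse (norm (resolvent_ell2 A z (u k)))) *\<^sub>C resolvent_ell2 A z (u k)"
    for k
  define F where "F k w = cinner_ell2 (resolvent_ell2 A w (u k)) (v k)" for k w
  have v: "norm (v k) \<le> 1" for k
    by (cases "resolvent_ell2 A z (u k) = 0") (simp_all add: v_def norm_inverse)
  have F_le: "cmod (F k w) \<le> onorm (resolvent_ell2 A w)" if "w \<notin> spectrum_ell2 A" for k w
  proof -
    have "cmod (F k w) \<le> norm (resolvent_ell2 A w (u k)) * norm (v k)"
      unfolding F_def by (rule norm_cinner_le)
    also have "\<dots> \<le> norm (resolvent_ell2 A w (u k))"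
      by (intro mult_right_le_one_le v) auto
    also have "\<dots> \<le> onorm (resolvent_ell2 A w)"
      using norm_resolvent_le[OF that, of "u k"] by (simp add: u)
    finally show ?thesis .
  qed
  have F_z: "cmod (F k z) = norm (resolvent_ell2 A z (u k))" for k
  proof -
    have "F k z = cnj (cinner_ell2 (v k) (resolvent_ell2 A z (u k)))"
      unfolding F_def by (rule cinner_commute)
    then show ?thesis
      by (cases "resolvent_ell2 A z (u k) = 0")
         (simp_all add: v_def cinner_cscale_left cinner_self norm_mult norm_inverse power2_eq_square)
  qed
  have lim_z: "(\<lambda>k. cmod (F k z)) \<longlonglongrightarrow> N"
  proof (rule real_tendsto_sandwich)
    show "\<forall>\<^sub>F k in sequentially. N - N / real (k + 2) \<le> cmod (F k z)"
      using u(2) by (simp add: F_z less_imp_le)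
    show "\<forall>\<^sub>F k in sequentially. cmod (F k z) \<le> N"
      using F_le[OF z] by (simp add: N_def)
    show "(\<lambda>k. N - N / real (k + 2)) \<longlonglongrightarrow> N"
    proof -
      have "(\<lambda>k. N / real (k + 2)) \<longlonglongrightarrow> 0"
        using LIMSEQ_ignore_initial_segment[OF lim_const_over_n, of N 2] by simp
      then show ?thesis
        using tendsto_diff[of "\<lambda>_. N" N sequentially "\<lambda>k. N / real (k + 2)" 0] by simp
    qed
  qed simp
  obtain f \<rho> where f: "f holomorphic_on - spectrum_ell2 A" "strict_mono (\<rho> :: nat \<Rightarrow> nat)"
      "\<And>w. w \<in> - spectrum_ell2 A \<Longrightarrow> (\<lambda>n. F (\<rho> n) w) \<longlonglongrightarrow> f w"
  proof (rule Montel[of "- spectrum_ell2 A" "range F" F])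
    show "open (- spectrum_ell2 A)"
      using closed_spectrum[OF A] by auto
    show "h holomorphic_on - spectrum_ell2 A" if "h \<in> range F" for h
      using that resolvent_coefficient_holomorphic by (auto simp: F_def[abs_def])
    show "\<exists>B. \<forall>h\<in>range F. \<forall>w\<in>K. cmod (h w) \<le> B"
      if K: "compact K" "K \<subseteq> - spectrum_ell2 A" for K
    proof -
      obtain M where M: "\<And>w. w \<in> K \<Longrightarrow> onorm (resolvent_ell2 A w) \<le> M"
        using resolvent_bounded_on_compact[OF K] by blast
      have "cmod (F k w) \<le> M" if "w \<in> K" for k w
        using order_trans[OF F_le M[OF that]] that K(2) by blast
      then show ?thesis by blast
    qed
  qed auto
  show ?thesis
  proof (rule that[OF f(1)])
    fix w assume "w \<notin> spectrum_ell2 A"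
    then show "cmod (f w) \<le> onorm (resolvent_ell2 A w)"
      using F_le by (intro tendsto_upperbound[OF tendsto_norm[OF f(3)]]) auto
  next
    have "(\<lambda>n. cmod (F (\<rho> n) z)) \<longlonglongrightarrow> N"
      using LIMSEQ_subseq_LIMSEQ[OF lim_z f(2)] by (simp add: o_def)
    moreover have "(\<lambda>n. cmod (F (\<rho> n) z)) \<longlonglongrightarrow> cmod (f z)"
      using z by (intro tendsto_norm f(3)) auto
    ultimately show "cmod (f z) = onorm (resolvent_ell2 A z)"
      unfolding N_def by (rule LIMSEQ_unique[symmetric])
  qed
qed

end

section \<open>Superlevel sets of the modulus of a holomorphic function\<close>

lemma path_component_in_path_connected:
  assumes "path_connected T" "x \<in> T" "y \<in> T" "T \<subseteq> S"
  shows "path_component S x y"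
  using assms path_component_of_subset path_connected_component by blast

text \<open>Near \<open>z\<close> one has \<open>f w = f z + \<psi>(w)^n\<close> with \<open>\<psi>\<close> injective and \<open>\<psi>(z) = 0\<close>; the path is the
  preimage under \<open>\<psi>\<close> of a segment in the direction of an \<open>n\<close>-th root of \<open>f z\<close>.\<close>

lemma holomorphic_modulus_increasing_path:
  assumes f: "f holomorphic_on S" "open S" "connected S" "\<not> f constant_on S"
    and z: "z \<in> S" "f z \<noteq> 0"
  obtains z' where "cmod (f z) < cmod (f z')"
    "path_component {w \<in> S. cmod (f z) \<le> cmod (f w)} z z'"
proof -
  \<comment> \<open>If all derivatives vanished at \<open>z\<close>, the identity theorem would make
    \<open>f\<close> constant.\<close>
  obtain n0 where n0: "n0 > 0 \<and> (deriv ^^ n0) f z \<noteq> 0"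
    using holomorphic_fun_eq_const_on_connected[OF f(1-3) _ z(1)] f(4)
    unfolding constant_on_def by metis
  define n where [abs_def]: "n = (LEAST n. n > 0 \<and> (deriv ^^ n) f z \<noteq> 0)"
  have n: "n > 0" "(deriv ^^ n) f z \<noteq> 0"
    using def_LeastI [OF n_def n0] by auto
  have n_min: "\<And>k. 0 < k \<Longrightarrow> k < n \<Longrightarrow> (deriv ^^ k) f z = 0"
    using def_Least_le [OF n_def] not_le by auto
  obtain g \<delta> where \<delta>: "0 < \<delta>" and g: "g holomorphic_on ball z \<delta>"
      and fd: "\<And>w. w \<in> ball z \<delta> \<Longrightarrow> f w - f z = ((w - z) * g w) ^ n"
      and gnz: "\<And>w. w \<in> ball z \<delta> \<Longrightarrow> g w \<noteq> 0"
    by (blast intro: n_min holomorphic_factor_order_of_zero_strong [OF f(1,2) z(1) n])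
  obtain \<delta>' where \<delta>': "0 < \<delta>'" "ball z \<delta>' \<subseteq> S"
    using f(2) z(1) openE by blast
  define D where "D = ball z (min \<delta> \<delta>')"
  have D: "open D" "z \<in> D" "D \<subseteq> S" "D \<subseteq> ball z \<delta>"
    using \<delta> \<delta>' by (auto simp: D_def)
  define \<psi> where "\<psi> w = (w - z) * g w" for w
  have g': "g holomorphic_on D" using g D holomorphic_on_subset by blast
  then have \<psi>: "\<psi> holomorphic_on D"
    unfolding \<psi>_def[abs_def] by (intro holomorphic_intros)
  \<comment> \<open>The factor w - z vanishes at \<open>z\<close>, so the product rule leaves only
    \<open>g z\<close>, which is nonzero; this gives the local inverse.\<close>
  have "(\<psi> has_field_derivative g z) (at z)"
  proof -
    have "(g has_field_derivative deriv g z) (at z)"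
      using holomorphic_derivI[OF g' D(1,2)] .
    then show ?thesis
      unfolding \<psi>_def[abs_def] by (auto intro!: derivative_eq_intros)
  qed
  then have "deriv \<psi> z \<noteq> 0"
    using gnz[of z] \<delta> by (simp add: DERIV_imp_deriv)
  then obtain s where s: "s > 0" "ball z s \<subseteq> D" "open (\<psi> ` ball z s)" "inj_on \<psi> (ball z s)"
    using has_complex_derivative_locally_invertible[OF \<psi> D(2,1)] by blast
  obtain \<phi> where \<phi>: "\<phi> holomorphic_on \<psi> ` ball z s" "\<And>w. w \<in> ball z s \<Longrightarrow> \<phi> (\<psi> w) = w"
    using holomorphic_has_inverse[OF holomorphic_on_subset[OF \<psi> s(2)] open_ball s(4)] by metis
  have "\<psi> z = 0" by (simp add: \<psi>_def)
  then have "0 \<in> \<psi> ` ball z s" using s(1) by (metis centre_in_ball imageI)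
  then obtain \<eta> where \<eta>: "\<eta> > 0" "ball 0 \<eta> \<subseteq> \<psi> ` ball z s"
    using s(3) openE by blast
  define c where "c = exp (Ln (f z) / of_nat n)"
  have c: "c ^ n = f z"
    using n z by (simp add: c_def flip: exp_of_nat_mult)
  have "c \<noteq> 0" by (simp add: c_def)
  \<comment> \<open>The segment from 0 to \<epsilon> c then has length \<eta> / 2 and stays in the
    ball where the inverse \<phi> is available.\<close>
  define \<epsilon> where "\<epsilon> = \<eta> / (2 * cmod c)"
  have \<epsilon>: "\<epsilon> > 0" using \<eta> \<open>c \<noteq> 0\<close> by (simp add: \<epsilon>_def)
  define \<gamma> where "\<gamma> t = \<phi> (of_real (t * \<epsilon>) * c)" for t
  have in_ball: "of_real (t * \<epsilon>) * c \<in> ball 0 \<eta>" if "t \<in> {0..1}" for t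
  proof -
    have "t * \<eta> \<le> 1 * \<eta>" using that \<eta> by (intro mult_right_mono) auto
    moreover have "cmod (of_real (t * \<epsilon>) * c) = t * \<eta> / 2"
      using that \<eta> \<open>c \<noteq> 0\<close> unfolding norm_mult norm_of_real by (simp add: \<epsilon>_def)
    ultimately have "cmod (of_real (t * \<epsilon>) * c) < \<eta>"
      using \<eta> by linarith
    then show ?thesis by simp
  qed
  have \<psi>\<gamma>: "\<psi> (\<gamma> t) = of_real (t * \<epsilon>) * c" "\<gamma> t \<in> ball z s" if t: "t \<in> {0..1}" for t
  proof -
    obtain w where "w \<in> ball z s" "\<psi> w = of_real (t * \<epsilon>) * c"
      using in_ball[OF t] \<eta>(2) by (metis imageE subsetD)
    then show "\<psi> (\<gamma> t) = of_real (t * \<epsilon>) * c" "\<gamma> t \<in> ball z s"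
      using \<phi>(2)[of w] by (simp_all add: \<gamma>_def del: of_real_mult)
  qed
  have f\<gamma>: "cmod (f (\<gamma> t)) = (1 + (t * \<epsilon>) ^ n) * cmod (f z)" if t: "t \<in> {0..1}" for t
  proof -
    have "f (\<gamma> t) - f z = \<psi> (\<gamma> t) ^ n"
      unfolding \<psi>_def using \<psi>\<gamma>(2)[OF t] s(2) D(4) by (intro fd) blast
    also have "\<dots> = of_real ((t * \<epsilon>) ^ n) * f z"
      unfolding \<psi>\<gamma>(1)[OF t] by (simp add: power_mult_distrib c)
    finally have "f (\<gamma> t) = of_real (1 + (t * \<epsilon>) ^ n) * f z"
      by (simp add: algebra_simps)
    moreover have "0 \<le> (t * \<epsilon>) ^ n" using t \<epsilon> by simp
    ultimately show ?thesis
      by (simp only: norm_mult norm_of_real)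
  qed
  show ?thesis
  proof (rule that[of "\<gamma> 1"])
    show "cmod (f z) < cmod (f (\<gamma> 1))"
      using z \<epsilon> by (simp add: f\<gamma>)
    have "continuous_on {0..1} \<gamma>"
      unfolding \<gamma>_def[abs_def]
    proof (rule continuous_on_compose2[OF holomorphic_on_imp_continuous_on[OF \<phi>(1)]])
      show "(\<lambda>t. of_real (t * \<epsilon>) * c) ` {0..1} \<subseteq> \<psi> ` ball z s"
        using in_ball \<eta>(2) by blast
    qed (intro continuous_intros)
    moreover have "\<gamma> 0 = z"
      using \<phi>(2)[of z] s(1) \<open>\<psi> z = 0\<close> by (simp add: \<gamma>_def)
    moreover have "\<gamma> t \<in> {w \<in> S. cmod (f z) \<le> cmod (f w)}" if t: "t \<in> {0..1}" for t
    proof -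
      have "1 * cmod (f z) \<le> (1 + (t * \<epsilon>) ^ n) * cmod (f z)"
        using t \<epsilon> by (intro mult_right_mono) auto
      then show ?thesis
        using \<psi>\<gamma>(2)[OF t] s(2) D(3) f\<gamma>[OF t] by auto
    qed
    ultimately show "path_component {w \<in> S. cmod (f z) \<le> cmod (f w)} z (\<gamma> 1)"
      unfolding path_component_def
      by (intro exI[of _ \<gamma>]) (auto simp: path_def path_image_def pathstart_def pathfinish_def)
  qed
qed

text \<open>When |f z| = c the point \<open>z\<close> lies outside the open set {|f| > c}, so it is
  first moved to a point of larger modulus. This fails only if \<open>f\<close> is constant on the
  component of \<open>z\<close> off \<sigma>; then that whole component lies in \<Lambda> and is
  bounded, so its own frontier meets \<sigma>. The point \<open>y\<close> is only in the closure of
  \<open>U\<close>, since a boundary point need not be the end of a path inside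
  \<open>U\<close>.\<close>

lemma superlevel_set_reaches_frontier:
  fixes f :: "complex \<Rightarrow> complex"
  assumes f: "f holomorphic_on - \<sigma>" and "closed \<sigma>" and "c > 0"
    and \<Lambda>: "bounded \<Lambda>" "{w. w \<notin> \<sigma> \<and> cmod (f w) \<ge> c} \<subseteq> \<Lambda>"
    and z: "z \<notin> \<sigma>" "cmod (f z) \<ge> c"
  obtains y U where "y \<in> frontier \<sigma>" "y \<in> closure U"
    "\<And>w. w \<in> U \<Longrightarrow> path_component \<Lambda> z w"
proof -
  note reach = that
  \<comment> \<open>Common end of both cases: a point of \<sigma> that is a limit of points off
    \<sigma> is a frontier point of \<sigma>.\<close>
  have step: thesis
    if U: "open U" "connected U" "z' \<in> U" "U \<subseteq> \<Lambda> - \<sigma>" and z': "path_component \<Lambda> z z'"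
      and fr: "frontier U \<inter> \<sigma> \<noteq> {}" for U z'
  proof -
    obtain y where y: "y \<in> frontier U" "y \<in> \<sigma>" using fr by blast
    have "y \<in> closure U" using y by (simp add: frontier_def)
    moreover have "y \<in> closure (- \<sigma>)"
      using calculation closure_mono[of U "- \<sigma>"] U(4) by blast
    then have "y \<in> frontier \<sigma>"
      using y closure_subset by (auto simp: frontier_closures)
    moreover have "path_component \<Lambda> z w" if "w \<in> U" for w
      using z' path_component_in_path_connected[of U z' w \<Lambda>] U that
        connected_open_path_connected path_component_trans by blast
    ultimately show thesis by (intro reach[of y U])
  qed
  define W where "W = connected_component_set (- \<sigma>) z"
  have W: "open W" "connected W" "z \<in> W" "W \<subseteq> - \<sigma>"
    using z open_connected_component[of "- \<sigma>" z] \<open>closed \<sigma>\<close> connected_component_subset[of "- \<sigma>" z]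
    by (simp_all add: W_def open_Compl)
  have fr_bounded: "frontier X \<noteq> {}" if "x \<in> X" "X \<subseteq> \<Lambda>" for x X
    using that bounded_subset[OF \<Lambda>(1), of X] by (intro frontier_not_empty) auto
  show thesis
  proof (cases "f constant_on W")
    case True
    then have fW: "\<And>w. w \<in> W \<Longrightarrow> f w = f z"
      using W(3) unfolding constant_on_def by metis
    have W\<Lambda>: "W \<subseteq> \<Lambda> - \<sigma>" using fW z \<Lambda>(2) W(4) by force
    have "frontier W \<subseteq> frontier \<sigma>"
      using frontier_of_connected_component_subset[of "- \<sigma>" z] by (simp add: W_def)
    then have "frontier W \<subseteq> \<sigma>"
      using \<open>closed \<sigma>\<close> frontier_subset_closed by blast
    then have "frontier W \<inter> \<sigma> \<noteq> {}"
      using fr_bounded[OF W(3)] W\<Lambda> by blast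
    with W W\<Lambda> show thesis
      by (intro step[of W z]) (auto intro!: path_component_refl)
  next
    case False
    obtain z' where z': "cmod (f z) < cmod (f z')"
        "path_component {w \<in> W. cmod (f z) \<le> cmod (f w)} z z'"
      using holomorphic_modulus_increasing_path[OF holomorphic_on_subset[OF f W(4)] W(1,2) False W(3)]
        z \<open>c > 0\<close> by (metis norm_zero not_le)
    have z'W: "z' \<in> W" using path_component_mem(2)[OF z'(2)] by auto
    have z'\<Lambda>: "path_component \<Lambda> z z'"
      using z \<Lambda>(2) W(4) by (intro path_component_of_subset[OF _ z'(2)]) force
    define V where "V = {w \<in> - \<sigma>. cmod (f w) > c}"
    have "open V"
    proof -
      have "open (- \<sigma> \<inter> (\<lambda>w. cmod (f w)) -` {c<..})"
        using \<open>closed \<sigma>\<close> f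
        by (intro continuous_open_preimage continuous_on_norm holomorphic_on_imp_continuous_on) auto
      also have "- \<sigma> \<inter> (\<lambda>w. cmod (f w)) -` {c<..} = V" by (auto simp: V_def)
      finally show ?thesis .
    qed
    define U where "U = connected_component_set V z'"
    have "z' \<in> V" using z' z z'W W(4) by (auto simp: V_def)
    then have U: "open U" "connected U" "z' \<in> U" "U \<subseteq> V"
      using \<open>open V\<close> connected_component_subset[of V z']
      by (simp_all add: U_def open_connected_component)
    have U\<Lambda>: "U \<subseteq> \<Lambda> - \<sigma>" using U(4) \<Lambda>(2) by (force simp: V_def)
    have "frontier U \<inter> \<sigma> \<noteq> {}"
    proof
      assume disj: "frontier U \<inter> \<sigma> = {}"
      \<comment> \<open>The frontier of a component of the open set \<open>V\<close> avoids
        \<open>V\<close>; being also off \<sigma>, it satisfies |f| <= c, while |f z'| > c.\<close>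
      have "frontier U \<subseteq> frontier V"
        unfolding U_def by (rule frontier_of_connected_component_subset)
      then have frV: "frontier U \<inter> V = {}"
        using \<open>open V\<close> by (auto simp: frontier_def interior_open)
      have cl: "closure U \<subseteq> - \<sigma>"
        using disj U\<Lambda> closure_Un_frontier[of U] by blast
      have "cmod (f z') \<le> c"
      proof (rule maximum_modulus_frontier[of f U])
        show "f holomorphic_on interior U"
          using holomorphic_on_subset[OF f] U\<Lambda> interior_subset by blast
        show "continuous_on (closure U) f"
          using holomorphic_on_imp_continuous_on[OF holomorphic_on_subset[OF f cl]] .
        show "bounded U" using bounded_subset[OF \<Lambda>(1), of U] U\<Lambda> by blast
        show "cmod (f w) \<le> c" if "w \<in> frontier U" for w
          using that disj frV by (force simp: V_def)
      qed (rule U(3))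
      with \<open>z' \<in> V\<close> show False by (simp add: V_def)
    qed
    with U U\<Lambda> z'\<Lambda> show thesis by (intro step[of U z']) auto
  qed
qed

section \<open>Reducing path-connectedness of the pseudospectrum to the frontier of the
  spectrum\<close>

context
  fixes A :: "'i ell2 \<Rightarrow> 'i ell2"
  assumes A: "bounded_clinear_ell2 A"
begin

text \<open>From an interior spectral point a ray runs inside the spectrum to its first frontier
  point, which exists by boundedness. From a point off the spectrum the superlevel set of the
  norming function leads close to the frontier.\<close>

lemma pseudospectrum_path_to_frontier_spectrum:
  assumes r: "r > 0" and z: "z \<in> pseudospectrum_ell2 r A"
  obtains s where "s \<in> frontier (spectrum_ell2 A)" "path_component (pseudospectrum_ell2 r A) z s"
proof (cases "z \<in> spectrum_ell2 A")
  case True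
  have sub: "spectrum_ell2 A \<subseteq> pseudospectrum_ell2 r A"
    using r by (auto simp: mem_pseudospectrum_iff[OF A])
  show ?thesis
  proof (cases "z \<in> interior (spectrum_ell2 A)")
    case False
    then show ?thesis
      using True that[of z] z closure_subset by (auto simp: frontier_def intro!: path_component_refl)
  next
    case True
    obtain d where d: "0 < d" "z + d *\<^sub>R (1 :: complex) \<in> frontier (spectrum_ell2 A)"
        "\<And>e. 0 \<le> e \<Longrightarrow> e < d \<Longrightarrow> z + e *\<^sub>R (1 :: complex) \<in> interior (spectrum_ell2 A)"
      using ray_to_frontier[OF bounded_spectrum[OF A] True, of 1] by auto
    have "closed_segment z (z + d *\<^sub>R 1) \<subseteq> spectrum_ell2 A"
    proof
      fix w assume "w \<in> closed_segment z (z + d *\<^sub>R 1)"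
      then obtain t where t: "0 \<le> t" "t \<le> 1" "w = (1 - t) *\<^sub>R z + t *\<^sub>R (z + d *\<^sub>R 1)"
        by (auto simp: in_segment)
      then have w: "w = z + (t * d) *\<^sub>R 1" by (simp add: algebra_simps)
      show "w \<in> spectrum_ell2 A"
      proof (cases "t = 1")
        case True
        then show ?thesis
          using d(2) w frontier_subset_closed[OF closed_spectrum[OF A]] by auto
      next
        case False
        then have "t * d < d" using t d by simp
        then show ?thesis
          unfolding w using d(1) t(1) interior_subset by (intro subsetD[OF _ d(3)]) auto
      qed
    qed
    then have "path_component (pseudospectrum_ell2 r A) z (z + d *\<^sub>R 1)"
      using sub by (intro path_component_linepath) blast
    then show ?thesis using that d(2) by blast
  qed
next
  case False
  have N: "onorm (resolvent_ell2 A z) \<ge> 1 / r"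
    using z False r by (simp add: mem_pseudospectrum_iff[OF A])
  then have "onorm (resolvent_ell2 A z) > 0"
    using r by (intro less_le_trans[OF _ N]) simp
  then obtain f where f: "f holomorphic_on - spectrum_ell2 A"
      "\<And>w. w \<notin> spectrum_ell2 A \<Longrightarrow> cmod (f w) \<le> onorm (resolvent_ell2 A w)"
      "cmod (f z) = onorm (resolvent_ell2 A z)"
    using norming_holomorphic_function[OF A False] by metis
  have sub: "{w. w \<notin> spectrum_ell2 A \<and> cmod (f w) \<ge> 1 / r} \<subseteq> pseudospectrum_ell2 r A"
    using f(2) by (force simp: mem_pseudospectrum_iff[OF A r])
  obtain y U where y: "y \<in> frontier (spectrum_ell2 A)" "y \<in> closure U"
      and U: "\<And>w. w \<in> U \<Longrightarrow> path_component (pseudospectrum_ell2 r A) z w"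
    using superlevel_set_reaches_frontier[OF f(1) closed_spectrum[OF A] _
        bounded_pseudospectrum[OF A r] sub False] r N f(3) by auto
  \<comment> \<open>The last gap, from \<open>U\<close> to its limit point \<open>y\<close>, is
    crossed in the disc of radius \<open>r\<close> about \<open>y\<close>.\<close>
  obtain w where w: "w \<in> U" "dist w y < r"
    using y(2) r closure_approachable by blast
  have "y \<in> spectrum_ell2 A"
    using y(1) frontier_subset_closed[OF closed_spectrum[OF A]] by blast
  then have "path_component (pseudospectrum_ell2 r A) w y"
    using w r cball_spectrum_subset_pseudospectrum[OF A r]
    by (intro path_component_in_path_connected[of "cball y r"])
       (auto simp: convex_imp_path_connected dist_commute)
  with U[OF w(1)] y(1) that show ?thesis
    using path_component_trans by blast
qed

text \<open>\<open>K\<close> serves as a hub: each point is joined to the frontier of the spectrum,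
  and from there to \<open>K\<close> within a disc about a spectral point.\<close>

theorem path_connected_pseudospectrum:
  assumes r: "r > 0" and K: "path_connected K" "K \<subseteq> pseudospectrum_ell2 r A"
    and near: "\<And>s. s \<in> frontier (spectrum_ell2 A) \<Longrightarrow> \<exists>k\<in>K. dist s k \<le> r"
  shows "path_connected (pseudospectrum_ell2 r A)"
proof -
  have to_K: "\<exists>k\<in>K. path_component (pseudospectrum_ell2 r A) z k"
    if z: "z \<in> pseudospectrum_ell2 r A" for z
  proof -
    obtain s where s: "s \<in> frontier (spectrum_ell2 A)"
        "path_component (pseudospectrum_ell2 r A) z s"
      using pseudospectrum_path_to_frontier_spectrum[OF r z] by blast
    obtain k where k: "k \<in> K" "dist s k \<le> r" using near[OF s(1)] by blast
    have "s \<in> spectrum_ell2 A"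
      using s(1) frontier_subset_closed[OF closed_spectrum[OF A]] by blast
    then have "path_component (pseudospectrum_ell2 r A) s k"
      using k r cball_spectrum_subset_pseudospectrum[OF A r]
      by (intro path_component_in_path_connected[of "cball s r"])
         (auto simp: convex_imp_path_connected)
    with s k show ?thesis using path_component_trans by blast
  qed
  show ?thesis
    unfolding path_connected_component
  proof (intro ballI)
    fix x y assume "x \<in> pseudospectrum_ell2 r A" "y \<in> pseudospectrum_ell2 r A"
    then obtain k l where "k \<in> K" "path_component (pseudospectrum_ell2 r A) x k"
        "l \<in> K" "path_component (pseudospectrum_ell2 r A) y l"
      using to_K by meson
    then show "path_component (pseudospectrum_ell2 r A) x y"
      using K path_component_in_path_connected path_component_sym path_component_trans by meson
  qed
qed

end

section \<open>Laurent and Jacobi operators\<close>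

lift_definition shift_ell2 :: "int \<Rightarrow> int ell2 \<Rightarrow> int ell2" is "\<lambda>k u n. u (n + k)"
proof -
  fix k :: int and u :: "int \<Rightarrow> complex"
  assume "(\<lambda>n. (cmod (u n))\<^sup>2) summable_on UNIV"
  then show "(\<lambda>n. (cmod (u (n + k)))\<^sup>2) summable_on UNIV"
    using summable_on_reindex[of "\<lambda>n. n + k" UNIV "\<lambda>n. (cmod (u n))\<^sup>2"] by (simp add: o_def)
qed

lemmas [simp] = shift_ell2.rep_eq

lemma shift_add: "shift_ell2 k (u + v) = shift_ell2 k u + shift_ell2 k v"
  and shift_diff: "shift_ell2 k (u - v) = shift_ell2 k u - shift_ell2 k v"
  and shift_cscale: "shift_ell2 k (z *\<^sub>C u) = z *\<^sub>C shift_ell2 k u"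
  and shift_shift: "shift_ell2 k (shift_ell2 l u) = shift_ell2 (k + l) u"
  and shift_zero: "shift_ell2 0 u = u"
  by (auto intro!: ell2_eqI simp: ac_simps)

lemma norm_shift [simp]: "norm (shift_ell2 k u) = norm u"
proof -
  have "(\<Sum>\<^sub>\<infinity>n. (cmod (ell2_nth u (n + k)))\<^sup>2) = (\<Sum>\<^sub>\<infinity>n. (cmod (ell2_nth u n))\<^sup>2)"
    using infsum_reindex[of "\<lambda>n. n + k" UNIV "\<lambda>n. (cmod (ell2_nth u n))\<^sup>2"] by (simp add: o_def)
  then show ?thesis by (simp add: norm_ell2.rep_eq)
qed

text \<open>Polarisation: the shift is additive and keeps norms, hence keeps the real inner product;
  commuting with complex scalars extends this to the imaginary part.\<close>

lemma cinner_shift: "cinner_ell2 (shift_ell2 k u) (shift_ell2 k v) = cinner_ell2 u v"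
proof -
  have "shift_ell2 k u \<bullet> shift_ell2 k v = u \<bullet> v" for u v
    by (simp add: dot_norm flip: shift_add)
  then show ?thesis
    by (simp add: cinner_ell2_def flip: shift_cscale)
qed

text \<open>The inverse shift is the adjoint of the shift. This makes the quadratic form of L
  real.\<close>

lemma cinner_shift_minus: "cinner_ell2 (shift_ell2 (- k) u) u = cnj (cinner_ell2 (shift_ell2 k u) u)"
  using cinner_shift[of k "shift_ell2 (- k) u" u] cinner_commute[of u "shift_ell2 k u"]
  by (simp add: shift_shift shift_zero)

lemma bounded_clinear_shift: "bounded_clinear_ell2 (shift_ell2 k)"
  by (rule bounded_clinear_ell2I[where C = 1]) (auto simp: shift_add shift_cscale)

lemma invertible_shift: "invertible_ell2 (shift_ell2 k)"
  unfolding invertible_ell2_def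
  by (rule exI[of _ "shift_ell2 (- k)"])
     (auto simp: bounded_clinear_shift fun_eq_iff shift_shift shift_zero)

text \<open>Factor out the dominant term, either \<beta> or \<alpha> times the shift; what remains
  is the identity plus a contraction.\<close>

lemma invertible_shift_linear:
  assumes "cmod \<alpha> \<noteq> cmod \<beta>"
  shows "invertible_ell2 (\<lambda>u. \<alpha> *\<^sub>C shift_ell2 1 u + \<beta> *\<^sub>C u)"
proof -
  have inv: "invertible_ell2 (\<lambda>u. u + \<gamma> *\<^sub>C shift_ell2 k u)" if "cmod \<gamma> < 1" for \<gamma> k
  proof (rule invertible_id_plus_contraction[where k = "cmod \<gamma>"])
    show "bounded_clinear_ell2 (\<lambda>u. \<gamma> *\<^sub>C shift_ell2 k u)"
      using bounded_clinear_compose[OF bounded_clinear_cscale bounded_clinear_shift]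
      by (simp add: o_def)
  qed (use that in auto)
  show ?thesis
  proof (cases "cmod \<alpha> < cmod \<beta>")
    case True
    then have "\<beta> \<noteq> 0" by auto
    with True have "invertible_ell2 ((\<lambda>u. \<beta> *\<^sub>C u) \<circ> (\<lambda>u. u + (\<alpha> / \<beta>) *\<^sub>C shift_ell2 1 u))"
      by (intro invertible_compose invertible_cscale inv) (auto simp: norm_divide)
    also have "(\<lambda>u. \<beta> *\<^sub>C u) \<circ> (\<lambda>u. u + (\<alpha> / \<beta>) *\<^sub>C shift_ell2 1 u)
        = (\<lambda>u. \<alpha> *\<^sub>C shift_ell2 1 u + \<beta> *\<^sub>C u)"
      using \<open>\<beta> \<noteq> 0\<close> by (simp add: fun_eq_iff cscale_distribs add.commute)
    finally show ?thesis .
  next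
    case False
    with assms have less: "cmod \<beta> < cmod \<alpha>" by simp
    then have "\<alpha> \<noteq> 0" by auto
    with less have "invertible_ell2 ((\<lambda>u. \<alpha> *\<^sub>C u) \<circ> (shift_ell2 1 \<circ>
        (\<lambda>u. u + (\<beta> / \<alpha>) *\<^sub>C shift_ell2 (- 1) u)))"
      by (intro invertible_compose invertible_cscale invertible_shift inv) (auto simp: norm_divide)
    also have "(\<lambda>u. \<alpha> *\<^sub>C u) \<circ> (shift_ell2 1 \<circ> (\<lambda>u. u + (\<beta> / \<alpha>) *\<^sub>C shift_ell2 (- 1) u))
        = (\<lambda>u. \<alpha> *\<^sub>C shift_ell2 1 u + \<beta> *\<^sub>C u)"
      using \<open>\<alpha> \<noteq> 0\<close>
      by (simp add: fun_eq_iff cscale_distribs shift_add shift_cscale shift_shift shift_zero)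
    finally show ?thesis .
  qed
qed

text \<open>Truncate the formal eigenvector n -> \<zeta>^n to a window of length N. Its squared norm
  is N, whereas the defect lives only at the two ends 0 and N and has squared norm 2.\<close>

lemma shift_approx_eigenvector:
  assumes "cmod \<zeta> = 1" "\<delta> > 0"
  obtains u where "u \<noteq> 0" "norm (shift_ell2 1 u - \<zeta> *\<^sub>C u) \<le> \<delta> * norm u"
proof -
  obtain N :: nat where N: "2 / \<delta>\<^sup>2 < real N" using reals_Archimedean2 by blast
  have "0 < 2 / \<delta>\<^sup>2" using assms by simp
  with N have "N > 0" by (metis of_nat_0_less_iff less_trans)
  define f where "f n = (if n \<in> {1..int N} then \<zeta> powi n else 0)" for n
  have norm_pow: "cmod (\<zeta> powi n) = 1" for n
    using assms by (simp add: norm_power_int)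
  have sum_f: "(\<lambda>n. (cmod (f n))\<^sup>2) summable_on UNIV"
    by (rule finite_nonzero_values_imp_summable_on)
       (rule finite_subset[of _ "{1..int N}"], auto simp: f_def)
  define u where "u = Abs_ell2 f"
  have u: "ell2_nth u = f" using sum_f by (simp add: u_def Abs_ell2_inverse)
  have "(norm u)\<^sup>2 = (\<Sum>\<^sub>\<infinity>n\<in>{1..int N}. 1)"
    unfolding norm_ell2_power2 u by (rule infsum_cong_neutral) (auto simp: f_def norm_pow)
  then have norm_u: "(norm u)\<^sup>2 = real N" by simp
  have "\<zeta> \<noteq> 0" using assms by auto
  have "(norm (shift_ell2 1 u - \<zeta> *\<^sub>C u))\<^sup>2 = (\<Sum>\<^sub>\<infinity>n\<in>{0, int N}. 1)"
    unfolding norm_ell2_power2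
  proof (rule infsum_cong_neutral)
    fix n
    have *: "ell2_nth (shift_ell2 1 u - \<zeta> *\<^sub>C u) n = f (n + 1) - \<zeta> * f n" by (simp add: u)
    show "(cmod (ell2_nth (shift_ell2 1 u - \<zeta> *\<^sub>C u) n))\<^sup>2 = 0" if "n \<in> UNIV - {0, int N}"
    proof -
      have "n \<in> {1..int N} \<longleftrightarrow> n + 1 \<in> {1..int N}" using that by auto
      then show ?thesis
        unfolding * f_def using \<open>\<zeta> \<noteq> 0\<close> by (simp add: power_int_add mult.commute)
    qed
    show "(cmod (ell2_nth (shift_ell2 1 u - \<zeta> *\<^sub>C u) n))\<^sup>2 = 1" if "n \<in> UNIV \<inter> {0, int N}"
      unfolding * f_def using that \<open>N > 0\<close> assms by (auto simp: norm_mult norm_pow)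
  qed simp
  then have "(norm (shift_ell2 1 u - \<zeta> *\<^sub>C u))\<^sup>2 = 2"
    using \<open>N > 0\<close> by simp
  also have "2 \<le> (\<delta> * norm u)\<^sup>2"
    using N assms by (simp add: power_mult_distrib norm_u field_simps)
  finally have "norm (shift_ell2 1 u - \<zeta> *\<^sub>C u) \<le> \<delta> * norm u"
    by (rule power2_le_imp_le) (use assms in simp)
  moreover have "u \<noteq> 0" using norm_u \<open>N > 0\<close> by auto
  ultimately show ?thesis using that by blast
qed

section \<open>Laurent operators and their spectra\<close>

definition laurent :: "complex \<Rightarrow> complex \<Rightarrow> complex \<Rightarrow> int ell2 \<Rightarrow> int ell2"
  where "laurent a b c u = a *\<^sub>C u + b *\<^sub>C shift_ell2 1 u + c *\<^sub>C shift_ell2 (- 1) u"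

text \<open>The formal eigenvalue of \<open>laurent a b c\<close> on the sequence n ->
  \<zeta>^n.\<close>

definition laurent_symbol :: "complex \<Rightarrow> complex \<Rightarrow> complex \<Rightarrow> complex \<Rightarrow> complex"
  where "laurent_symbol a b c \<zeta> = a + b * \<zeta> + c * inverse \<zeta>"

lemma bounded_clinear_laurent: "bounded_clinear_ell2 (laurent a b c)"
proof -
  have "bounded_clinear_ell2 (\<lambda>u. z *\<^sub>C shift_ell2 k u)" for z k
    using bounded_clinear_compose[OF bounded_clinear_cscale bounded_clinear_shift]
    by (simp add: o_def)
  then show ?thesis
    unfolding laurent_def[abs_def] by (intro bounded_clinear_add bounded_clinear_cscale)
qed

lemma laurent_approx_eigenvector:
  assumes "cmod \<zeta> = 1" "\<delta> > 0"
  obtains u where "u \<noteq> 0" "norm (laurent_symbol a b c \<zeta> *\<^sub>C u - laurent a b c u) \<le> \<delta> * norm u"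
proof -
  \<comment> \<open>The defect for the Laurent operator is a combination of the shift defect x and
    its inverse shift, of norm at most (|b| + |c|) |x|; the added 1 makes \<open>M\<close>
    positive.\<close>
  define M where "M = cmod b + cmod c + 1"
  have M: "M > 0" by (simp add: M_def add_nonneg_pos)
  obtain u where u: "u \<noteq> 0" "norm (shift_ell2 1 u - \<zeta> *\<^sub>C u) \<le> \<delta> / M * norm u"
    using shift_approx_eigenvector[OF assms(1), of "\<delta> / M"] assms(2) M by auto
  define x where "x = shift_ell2 1 u - \<zeta> *\<^sub>C u"
  have "\<zeta> \<noteq> 0" using assms by auto
  have "shift_ell2 (- 1) x = u - \<zeta> *\<^sub>C shift_ell2 (- 1) u"
    by (simp add: x_def shift_diff shift_shift shift_zero shift_cscale)
  then have "laurent_symbol a b c \<zeta> *\<^sub>C u - laurent a b c u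
      = (c * inverse \<zeta>) *\<^sub>C shift_ell2 (- 1) x - b *\<^sub>C x"
    using \<open>\<zeta> \<noteq> 0\<close> unfolding x_def laurent_def laurent_symbol_def
    by (simp add: cscale_distribs mult.assoc)
  then have "norm (laurent_symbol a b c \<zeta> *\<^sub>C u - laurent a b c u) \<le> cmod c * norm x + cmod b * norm x"
    using norm_triangle_ineq4[of "(c * inverse \<zeta>) *\<^sub>C shift_ell2 (- 1) x" "b *\<^sub>C x"] assms(1)
    by (simp add: norm_mult norm_inverse)
  also have "\<dots> \<le> M * norm x" by (simp add: M_def algebra_simps)
  also have "\<dots> \<le> \<delta> * norm u"
    using u(2) M by (simp add: x_def[symmetric] field_simps)
  finally show ?thesis using that u(1) by blast
qed

text \<open>Splits the binary form A X^2 + B X Y + C Y^2 into two linear forms. Working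
  homogeneously admits A = 0, which arises when the superdiagonal vanishes.\<close>

lemma quadratic_factorization:
  fixes A B C :: complex
  obtains \<alpha> \<beta> \<alpha>' \<beta>' where "A = \<alpha> * \<alpha>'" "B = \<alpha> * \<beta>' + \<beta> * \<alpha>'" "C = \<beta> * \<beta>'"
proof (cases "A = 0")
  case True
  then show ?thesis by (intro that[of 0 B C 1]) auto
next
  case False
  define d where "d = csqrt (B\<^sup>2 - 4 * A * C)"
  have "d\<^sup>2 = B\<^sup>2 - 4 * A * C" by (simp add: d_def)
  then have "C = (B - d) / 2 * ((B + d) / (2 * A))"
    using False by (simp add: field_simps power2_eq_square)
  then show ?thesis
    using False by (intro that[of A 1 "(B + d) / (2 * A)" "(B - d) / 2"]) (auto simp: field_simps)
qed

text \<open>Symbol values have approximate eigenvectors. Conversely, with S the shift, z - L is the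
  inverse shift times (\<alpha> S + \<beta>) (\<alpha>' S + \<beta>'); if z is no symbol value,
  neither factor has a root on the unit circle, and both are invertible.\<close>

lemma spectrum_laurent: "spectrum_ell2 (laurent a b c) = laurent_symbol a b c ` sphere 0 1"
proof (intro equalityI subsetI)
  fix z assume "z \<in> laurent_symbol a b c ` sphere 0 1"
  then obtain \<zeta> where \<zeta>: "cmod \<zeta> = 1" "z = laurent_symbol a b c \<zeta>" by auto
  show "z \<in> spectrum_ell2 (laurent a b c)"
  proof (rule approx_eigenvectors_mem_spectrum[OF bounded_clinear_laurent])
    fix \<delta> :: real assume "\<delta> > 0"
    then show "\<exists>u. u \<noteq> 0 \<and> norm (z *\<^sub>C u - laurent a b c u) \<le> \<delta> * norm u"
      using laurent_approx_eigenvector[OF \<zeta>(1), of \<delta> a b c] \<zeta>(2) by metis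
  qed
next
  fix z assume z: "z \<in> spectrum_ell2 (laurent a b c)"
  show "z \<in> laurent_symbol a b c ` sphere 0 1"
  proof (rule ccontr)
    assume nz: "z \<notin> laurent_symbol a b c ` sphere 0 1"
    obtain \<alpha> \<beta> \<alpha>' \<beta>' where f: "- b = \<alpha> * \<alpha>'" "z - a = \<alpha> * \<beta>' + \<beta> * \<alpha>'" "- c = \<beta> * \<beta>'"
      using quadratic_factorization[of "- b" "z - a" "- c"] by metis
    have root: False if "cmod \<zeta> = 1" "\<alpha> * \<zeta> + \<beta> = 0 \<or> \<alpha>' * \<zeta> + \<beta>' = 0" for \<zeta>
    proof -
      have "\<zeta> \<noteq> 0" using that by auto
      have "(z - a) * \<zeta> - b * \<zeta> * \<zeta> - c = (\<alpha> * \<zeta> + \<beta>) * (\<alpha>' * \<zeta> + \<beta>')"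
      proof -
        have bc: "b = - (\<alpha> * \<alpha>')" "c = - (\<beta> * \<beta>')"
          by (simp_all flip: f)
        show ?thesis
          unfolding f(2) bc by (simp add: algebra_simps)
      qed
      then have "(z - a) * \<zeta> - b * \<zeta> * \<zeta> - c = 0"
        using that(2) by auto
      then have "z = laurent_symbol a b c \<zeta>"
        using \<open>\<zeta> \<noteq> 0\<close> by (simp add: laurent_symbol_def field_simps)
      then show False using nz that(1) by auto
    qed
    \<comment> \<open>Equal moduli would give the unimodular root - y / x, or the root 1 if both
      coefficients vanish.\<close>
    have ne: "cmod x \<noteq> cmod y" if "\<And>\<zeta>. cmod \<zeta> = 1 \<Longrightarrow> x * \<zeta> + y \<noteq> 0" for x y
    proof
      assume eq: "cmod x = cmod y"
      show False
      proof (cases "x = 0")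
        case True
        then show False using that[of 1] eq by simp
      next
        case False
        then show False using that[of "- y / x"] eq[symmetric] by (simp add: norm_divide)
      qed
    qed
    have "invertible_ell2 (shift_ell2 (- 1) \<circ> ((\<lambda>u. \<alpha> *\<^sub>C shift_ell2 1 u + \<beta> *\<^sub>C u)
        \<circ> (\<lambda>u. \<alpha>' *\<^sub>C shift_ell2 1 u + \<beta>' *\<^sub>C u)))"
      using root by (intro invertible_compose invertible_shift invertible_shift_linear ne) blast+
    also have "shift_ell2 (- 1) \<circ> ((\<lambda>u. \<alpha> *\<^sub>C shift_ell2 1 u + \<beta> *\<^sub>C u)
        \<circ> (\<lambda>u. \<alpha>' *\<^sub>C shift_ell2 1 u + \<beta>' *\<^sub>C u)) = (\<lambda>u. z *\<^sub>C u - laurent a b c u)"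
    proof
      fix u
      have "z *\<^sub>C u - laurent a b c u
          = (- b) *\<^sub>C shift_ell2 1 u + (z - a) *\<^sub>C u + (- c) *\<^sub>C shift_ell2 (- 1) u"
        by (simp add: laurent_def cscale_distribs)
      then show "(shift_ell2 (- 1) \<circ> ((\<lambda>u. \<alpha> *\<^sub>C shift_ell2 1 u + \<beta> *\<^sub>C u)
          \<circ> (\<lambda>u. \<alpha>' *\<^sub>C shift_ell2 1 u + \<beta>' *\<^sub>C u))) u = z *\<^sub>C u - laurent a b c u"
        unfolding f
        by (simp add: cscale_distribs shift_add shift_cscale shift_shift shift_zero mult.commute)
    qed
    finally show False using z by (simp add: spectrum_iff)
  qed
qed

section \<open>Jacobi operators as perturbations of Laurent operators\<close>

definition weight_ell2 :: "(int \<Rightarrow> real) \<Rightarrow> int ell2 \<Rightarrow> int ell2"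
  where "weight_ell2 w u = Abs_ell2 (\<lambda>n. of_real (w n) * ell2_nth u n)"

lemma weight_ell2:
  assumes "finite (range w)"
  shows weight_nth: "ell2_nth (weight_ell2 w u) n = of_real (w n) * ell2_nth u n"
    and norm_weight_le: "(\<And>n. \<bar>w n\<bar> \<le> C) \<Longrightarrow> norm (weight_ell2 w u) \<le> C * norm u"
proof -
  have nth: "ell2_nth (weight_ell2 w u) n = of_real (w n) * ell2_nth u n" for n
    using ell2_bounded_mult_shift_mem[OF assms, of 0 u 0]
    by (simp add: weight_ell2_def Abs_ell2_inverse)
  then show "ell2_nth (weight_ell2 w u) n = of_real (w n) * ell2_nth u n" .
  assume C: "\<And>n. \<bar>w n\<bar> \<le> C"
  have "(\<Sum>\<^sub>\<infinity>n. (cmod (ell2_nth (weight_ell2 w u) n))\<^sup>2) \<le> (\<Sum>\<^sub>\<infinity>n. C\<^sup>2 * (cmod (ell2_nth u n))\<^sup>2)"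
  proof (rule infsum_mono)
    show "(cmod (ell2_nth (weight_ell2 w u) n))\<^sup>2 \<le> C\<^sup>2 * (cmod (ell2_nth u n))\<^sup>2" for n
      using power_mono[OF C[of n], of 2]
      by (simp add: nth norm_mult power_mult_distrib mult_right_mono)
  qed (intro ell2_nth_summable summable_on_cmult_right)+
  then have "(norm (weight_ell2 w u))\<^sup>2 \<le> (C * norm u)\<^sup>2"
    by (simp add: norm_ell2_power2 power_mult_distrib infsum_cmult_right')
  then show "norm (weight_ell2 w u) \<le> C * norm u"
    by (rule power2_le_imp_le) (use order_trans[OF abs_ge_zero C[of 0]] in simp)
qed

context
  fixes a b c :: "int \<Rightarrow> real" and p :: nat
  assumes per: "p \<ge> 1" "periodic_seq p a" "periodic_seq p b" "periodic_seq p c"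
begin

lemma jacobi_perturbation:
  assumes "\<And>n. \<bar>a n - \<alpha>\<bar> \<le> A" "\<And>n. \<bar>b n - \<beta>\<bar> \<le> B" "\<And>n. \<bar>c n - \<gamma>\<bar> \<le> C"
  shows "norm (jacobi a b c u - laurent (of_real \<alpha>) (of_real \<beta>) (of_real \<gamma>) u) \<le> (A + B + C) * norm u"
proof -
  have fin: "finite (range (\<lambda>n. w n - k))" if "periodic_seq p w" for w and k :: real
    using finite_imageI[OF periodic_seq_finite_range[OF per(1) that], of "\<lambda>x. x - k"]
    by (simp add: image_image)
  define Ea where "Ea = weight_ell2 (\<lambda>n. a n - \<alpha>)"
  define Eb where "Eb = weight_ell2 (\<lambda>n. b n - \<beta>)"
  define Ec where "Ec = weight_ell2 (\<lambda>n. c n - \<gamma>)"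
  \<comment> \<open>In the subdiagonal term weight and vector are read at the same index n - 1, so
    there the weight acts before the shift; on the superdiagonal it acts after.\<close>
  have "jacobi a b c u - laurent (of_real \<alpha>) (of_real \<beta>) (of_real \<gamma>) u
      = Ea u + Eb (shift_ell2 1 u) + shift_ell2 (- 1) (Ec u)"
    by (rule ell2_eqI)
       (simp add: jacobi_nth[OF per] laurent_def Ea_def Eb_def Ec_def weight_nth[OF fin] per algebra_simps)
  also have "norm \<dots> \<le> norm (Ea u) + norm (Eb (shift_ell2 1 u)) + norm (shift_ell2 (- 1) (Ec u))"
    by (intro norm_triangle_mono norm_triangle_ineq order_refl)
  also have "\<dots> \<le> A * norm u + B * norm (shift_ell2 1 u) + C * norm u"
    unfolding norm_shift[of "- 1"] Ea_def Eb_def Ec_def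
    by (intro add_mono norm_weight_le fin per assms)
  finally show ?thesis by (simp add: algebra_simps)
qed

lemma bounded_clinear_jacobi: "bounded_clinear_ell2 (jacobi a b c)"
proof -
  obtain A where A: "\<And>n. \<bar>a n\<bar> \<le> A"
    using finite_imp_bounded[OF periodic_seq_finite_range[OF per(1,2)]] by (auto simp: bounded_iff)
  obtain B where B: "\<And>n. \<bar>b n\<bar> \<le> B"
    using finite_imp_bounded[OF periodic_seq_finite_range[OF per(1,3)]] by (auto simp: bounded_iff)
  obtain C where C: "\<And>n. \<bar>c n\<bar> \<le> C"
    using finite_imp_bounded[OF periodic_seq_finite_range[OF per(1,4)]] by (auto simp: bounded_iff)
  show ?thesis
  proof (rule bounded_clinear_ell2I[where C = "A + B + C"])
    \<comment> \<open>With all three constants zero the Laurent operator vanishes, and the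
      perturbation bound becomes a bound for J.\<close>
    show "norm (jacobi a b c u) \<le> (A + B + C) * norm u" for u
      using jacobi_perturbation[of 0 A 0 B 0 C u] A B C by (simp add: laurent_def)
  qed (auto intro!: ell2_eqI simp: jacobi_nth[OF per] algebra_simps)
qed

text \<open>The tolerance r - (A + B + C) is spent on approximate eigenvectors twice: on those of L
  to place \<open>K\<close> in the pseudospectrum of J, and on those of J to place frontier points
  near \<open>K\<close>.\<close>

lemma path_connected_pseudospectrum_jacobi:
  assumes dev: "\<And>n. \<bar>a n - a 0\<bar> \<le> A" "\<And>n. \<bar>b n - b 0\<bar> \<le> B" "\<And>n. \<bar>c n - b 0\<bar> \<le> C"
    and r: "A + B + C < r"
  shows "path_connected (pseudospectrum_ell2 r (jacobi a b c))"
proof (rule path_connected_pseudospectrum[OF bounded_clinear_jacobi])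
  define L where "L = laurent (of_real (a 0)) (of_real (b 0)) (of_real (b 0))"
  \<comment> \<open>The values a_0 + 2 b_0 cos \<theta> of the symbol of L on the unit
    circle.\<close>
  define K where "K = (\<lambda>t. complex_of_real (a 0 + 2 * b 0 * t)) ` {- 1..1}"
  have pert: "norm (jacobi a b c u - L u) \<le> (A + B + C) * norm u" for u
    unfolding L_def by (rule jacobi_perturbation[OF dev])
  have nonneg: "0 \<le> A + B + C"
    using order_trans[OF abs_ge_zero dev(1)] order_trans[OF abs_ge_zero dev(2)]
      order_trans[OF abs_ge_zero dev(3)] by simp
  with r show "r > 0" by simp
  show "path_connected K"
    unfolding K_def by (intro path_connected_continuous_image continuous_intros) simp
  show "K \<subseteq> pseudospectrum_ell2 r (jacobi a b c)"
  proof
    fix k assume "k \<in> K"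
    then obtain t where t: "- 1 \<le> t" "t \<le> 1" "k = of_real (a 0 + 2 * b 0 * t)"
      by (auto simp: K_def)
    \<comment> \<open>A unimodular number with real part \<open>t\<close>, so that \<zeta> plus its
      inverse is 2 t.\<close>
    define \<zeta> where "\<zeta> = Complex t (sqrt (1 - t\<^sup>2))"
    have "t\<^sup>2 \<le> 1" using t by (simp add: abs_square_le_1 abs_le_iff)
    then have \<zeta>: "cmod \<zeta> = 1" by (simp add: \<zeta>_def cmod_def)
    then have "\<zeta> * cnj \<zeta> = 1" using complex_norm_square[of \<zeta>] by simp
    then have "inverse \<zeta> = cnj \<zeta>" by (rule inverse_unique)
    then have k: "k = laurent_symbol (of_real (a 0)) (of_real (b 0)) (of_real (b 0)) \<zeta>"
      by (simp add: laurent_symbol_def t(3) complex_eq_iff \<zeta>_def)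
    obtain u where u: "u \<noteq> 0" "norm (k *\<^sub>C u - L u) \<le> (r - (A + B + C)) * norm u"
      using laurent_approx_eigenvector[OF \<zeta>] r unfolding k L_def by (metis diff_gt_0_iff_gt)
    have "norm (k *\<^sub>C u - jacobi a b c u) \<le> norm (k *\<^sub>C u - L u) + norm (jacobi a b c u - L u)"
      using norm_triangle_ineq4[of "k *\<^sub>C u - L u" "jacobi a b c u - L u"] by simp
    also have "\<dots> \<le> r * norm u"
      using u(2) pert[of u] by (simp add: algebra_simps)
    finally show "k \<in> pseudospectrum_ell2 r (jacobi a b c)"
      using u(1) \<open>r > 0\<close> by (intro approx_eigenvector_mem_pseudospectrum[OF bounded_clinear_jacobi])
  qed
  fix s assume s: "s \<in> frontier (spectrum_ell2 (jacobi a b c))"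
  obtain u where u: "u \<noteq> 0" "norm (s *\<^sub>C u - jacobi a b c u) \<le> (r - (A + B + C)) * norm u"
    using frontier_spectrum_approx_eigenvector[OF bounded_clinear_jacobi s] r
    by (metis diff_gt_0_iff_gt)
  have le: "norm (s *\<^sub>C u - L u) \<le> r * norm u"
    using norm_triangle_ineq[of "s *\<^sub>C u - jacobi a b c u" "jacobi a b c u - L u"] u(2) pert[of u]
    by (simp add: algebra_simps)
  \<comment> \<open>The Rayleigh quotient at \<open>u\<close> of half the sum of the shift and its
    inverse; so \<open>k\<close> is the Rayleigh quotient of L, and Cauchy-Schwarz puts it in
    \<open>K\<close>.\<close>
  define t where "t = Re (cinner_ell2 (shift_ell2 1 u) u) / (norm u)\<^sup>2"
  define k where "k = complex_of_real (a 0 + 2 * b 0 * t)"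
  have "\<bar>Re (cinner_ell2 (shift_ell2 1 u) u)\<bar> \<le> (norm u)\<^sup>2"
    using norm_cinner_le[of "shift_ell2 1 u" u] abs_Re_le_cmod[of "cinner_ell2 (shift_ell2 1 u) u"]
    by (simp add: power2_eq_square)
  then have "\<bar>t\<bar> \<le> 1" using u(1) by (simp add: t_def divide_le_eq)
  then have "k \<in> K" by (auto simp: K_def k_def abs_le_iff)
  have "cinner_ell2 (s *\<^sub>C u - L u) u = (s - k) * of_real ((norm u)\<^sup>2)"
  proof -
    have "cinner_ell2 (L u) u = of_real (a 0) * of_real ((norm u)\<^sup>2)
        + of_real (b 0) * of_real (2 * Re (cinner_ell2 (shift_ell2 1 u) u))"
      unfolding L_def laurent_def cinner_add_left cinner_cscale_left cinner_self cinner_shift_minus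
      by (simp add: complex_eq_iff algebra_simps)
    also have "Re (cinner_ell2 (shift_ell2 1 u) u) = t * (norm u)\<^sup>2"
      using u(1) by (simp add: t_def)
    finally show ?thesis
      by (simp add: cinner_diff_left cinner_cscale_left cinner_self k_def algebra_simps)
  qed
  then have "cmod (s - k) * (norm u)\<^sup>2 \<le> norm (s *\<^sub>C u - L u) * norm u"
    using norm_cinner_le[of "s *\<^sub>C u - L u" u] by (simp add: norm_mult norm_power)
  also have "\<dots> \<le> r * norm u * norm u"
    by (intro mult_right_mono le) simp
  finally have "dist s k \<le> r"
    using u(1) by (simp add: dist_norm power2_eq_square mult.assoc)
  with \<open>k \<in> K\<close> show "\<exists>k\<in>K. dist s k \<le> r" by blast
qed

lemma path_connected_spectrum_jacobi_constant:
  assumes "\<And>n. a n = \<alpha>" "\<And>n. b n = \<beta>" "\<And>n. c n = \<gamma>"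
  shows "path_connected (spectrum_ell2 (jacobi a b c))"
proof -
  \<comment> \<open>All deviations are zero, so the perturbation bound forces equality.\<close>
  have "jacobi a b c = laurent (of_real \<alpha>) (of_real \<beta>) (of_real \<gamma>)"
    using jacobi_perturbation[of \<alpha> 0 \<beta> 0 \<gamma> 0] assms by (simp add: fun_eq_iff)
  moreover have "path_connected (laurent_symbol (of_real \<alpha>) (of_real \<beta>) (of_real \<gamma>) ` sphere 0 1)"
    unfolding laurent_symbol_def[abs_def]
    by (intro path_connected_continuous_image path_connected_sphere continuous_intros) auto
  ultimately show ?thesis by (simp add: spectrum_laurent)
qed

end

lemma abs_diff_le_osc0:
  assumes "p \<ge> 1" "periodic_seq p a"
  shows "\<bar>a n - a 0\<bar> \<le> osc0 a"
proof -
  \<comment> \<open>\<open>osc0\<close> sees only nonnegative indices; reduction modulo the period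
    brings a negative \<open>n\<close> among them.\<close>
  have "\<bar>a (n mod int p) - a 0\<bar> \<le> osc0 a"
    unfolding osc0_def using assms(1) by (intro Max_ge finite_osc0[OF assms]) auto
  then show ?thesis by (simp add: periodic_seq_mod[OF assms(2)])
qed

theorem theorem3p9:
  fixes a b c :: "int \<Rightarrow> real" and p :: nat
  assumes "p \<ge> 1"
    and "periodic_seq p a" and "periodic_seq p b" and "periodic_seq p c"
  defines "\<omega>\<^sub>b\<^sub>c \<equiv> Max {\<bar>b 0 - c i\<bar> | i. 0 \<le> i \<and> i \<le> int p - 1}"
  defines "r \<equiv> 3 * sqrt ((real p - 1) * ((osc0 a)\<^sup>2 + (osc0 b)\<^sup>2 + \<omega>\<^sub>b\<^sub>c\<^sup>2))"
  shows "path_connected (pseudospectrum_ell2 r (jacobi a b c))"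
proof -
  define Q where "Q = (osc0 a)\<^sup>2 + (osc0 b)\<^sup>2 + \<omega>\<^sub>b\<^sub>c\<^sup>2"
  have Q: "Q \<ge> 0" by (simp add: Q_def)
  have c: "\<bar>c n - b 0\<bar> \<le> \<omega>\<^sub>b\<^sub>c" for n
  proof -
    have "finite {\<bar>b 0 - c i\<bar> | i. 0 \<le> i \<and> i \<le> int p - 1}"
      by (rule finite_subset[of _ "(\<lambda>i. \<bar>b 0 - c i\<bar>) ` {0..int p - 1}"]) auto
    moreover have "n mod int p \<le> int p - 1"
      using assms(1) pos_mod_bound[of "int p" n] by simp
    ultimately have "\<bar>b 0 - c (n mod int p)\<bar> \<le> \<omega>\<^sub>b\<^sub>c"
      unfolding \<omega>\<^sub>b\<^sub>c_def using assms(1) by (intro Max_ge) auto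
    then show ?thesis by (simp add: periodic_seq_mod[OF assms(4)] abs_minus_commute)
  qed
  note dev = abs_diff_le_osc0[OF assms(1,2)] abs_diff_le_osc0[OF assms(1,3)] c
  show ?thesis
  proof (cases "r > 0")
    case True
    have "p \<noteq> 1" using True by (auto simp: r_def)
    then have "Q \<le> (real p - 1) * Q" using assms(1) Q by (simp add: mult_le_cancel_right1)
    have r2: "r\<^sup>2 = 9 * ((real p - 1) * Q)"
      using assms(1) Q by (simp add: r_def Q_def power_mult_distrib)
    have "r\<^sup>2 > 0" using True by simp
    then have "Q > 0" using Q r2 by (cases "Q = 0") auto
    \<comment> \<open>Cauchy-Schwarz for three summands, made explicit by the pairwise differences;
      then 3 Q < 9 Q <= r^2.\<close>
    have "(osc0 a + osc0 b + \<omega>\<^sub>b\<^sub>c)\<^sup>2 \<le> 3 * Q"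
    proof -
      have "3 * Q - (osc0 a + osc0 b + \<omega>\<^sub>b\<^sub>c)\<^sup>2
          = (osc0 a - osc0 b)\<^sup>2 + (osc0 a - \<omega>\<^sub>b\<^sub>c)\<^sup>2 + (osc0 b - \<omega>\<^sub>b\<^sub>c)\<^sup>2"
        by (simp add: Q_def power2_eq_square algebra_simps)
      then show ?thesis by (smt (verit) zero_le_power2)
    qed
    also have "\<dots> < r\<^sup>2" using r2 \<open>Q \<le> _\<close> \<open>Q > 0\<close> by simp
    finally have "osc0 a + osc0 b + \<omega>\<^sub>b\<^sub>c < r"
      by (rule power2_less_imp_less) (use True in simp)
    then show ?thesis
      by (rule path_connected_pseudospectrum_jacobi[OF assms(1-4) dev])
  next
    case False
    \<comment> \<open>Now r = 0 and the pseudospectrum is the spectrum. Whichever factor under the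
      root vanishes, all three sequences are constant.\<close>
    have "\<not> 0 < (real p - 1) * Q"
      using False by (simp add: r_def Q_def)
    moreover have "0 \<le> (real p - 1) * Q"
      using assms(1) Q by simp
    ultimately have "(real p - 1) * Q = 0" by linarith
    then consider "p = 1" | "Q = 0" by auto
    then have "\<exists>\<alpha> \<beta> \<gamma>. (\<forall>n. a n = \<alpha>) \<and> (\<forall>n. b n = \<beta>) \<and> (\<forall>n. c n = \<gamma>)"
    proof cases
      case 1
      then have "w n = w 0" if "periodic_seq p w" for w :: "int \<Rightarrow> real" and n
        using periodic_seq_mod[OF that, of n] by simp
      then show ?thesis using assms(2-4) by metis
    next
      case 2
      then have "osc0 a = 0" "osc0 b = 0" "\<omega>\<^sub>b\<^sub>c = 0"
        by (auto simp: Q_def add_nonneg_eq_0_iff)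
      then have "a n = a 0" "b n = b 0" "c n = b 0" for n
        using dev(1,2,3)[of n] by simp_all
      then show ?thesis by metis
    qed
    then have "path_connected (spectrum_ell2 (jacobi a b c))"
      using path_connected_spectrum_jacobi_constant[OF assms(1-4)] by blast
    then show ?thesis using False by (simp add: pseudospectrum_ell2_def)
  qed
qed

end
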